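(* Let $\omega(k)=-k^3$, $g_0\in H^1([0,T])$, and let $q$ be the solution of $q_t+q_{xxx}=0$, $x>0$, $t\in(0,T]$, with zero initial data $q(\cdot,0)=0$ and boundary data $q(0,\cdot)=g_0$. Then for every $(s,\tau)\in\overline{\mathbb R^+\times(0,T)}$ (including $(s,\tau)=(0,0)$), as $(x,t)\to(s,\tau)$ with $x>0$, $0<t\le T$, $$q(x,t)=-3g_0(0)\,I_{\omega,0,1}(x,t)-\frac3{2\pi}\int_{\partial D_1^+}e^{iks-i\omega(k)\tau}\,G_{0,0}(k)\,\frac{dk}{ik}+\mathcal O\big(|x-s|^{1/2}+|t-\tau|^{1/6}\big),$$ where $G_{0,0}(k)=\int_0^te^{i\omega(k)s'}g_0'(s')\,ds'$.
   Context: For a fixed $R>0$ let $D_1^+=\{k:\ \pi/3\le\arg k\le2\pi/3,\ |k|\ge R\}$; its boundary is oriented with the region on the left, so $\partial D_1^+$ runs from $e^{2\pi i/3}\infty$ to $e^{i\pi/3}\infty$, avoiding the origin. Integrals over unbounded contours are limits, as $r\to\infty$, of the integrals over the part of the contour in $\{|k|<r\}$. The solution is given for $x>0$, $0<t\le T$ by $$q(x,t)=-\frac1{2\pi}\int_{\partial D_1^+}3k^2e^{ikx-i\omega(k)t}\,\tilde g_0(-\omega(k),t)\,dk,\qquad \tilde g_0(\kappa,t)=\int_0^te^{-i\kappa s}g_0(s)\,ds,$$ and $$I_{\omega,0,1}(x,t)=\frac1{2\pi}\int_{\partial D_1^+}e^{ikx-i\omega(k)t}\frac{dk}{ik}.$$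 Note that $G_{0,0}$ depends on $t$ (the same $t$ as in $q(x,t)$). *)

theory Defs
  imports "HOL-Complex_Analysis.Complex_Analysis" "HOL-Library.Landau_Symbols"
begin

definition square_integrable_on :: "(real \<Rightarrow> complex) \<Rightarrow> real set \<Rightarrow> bool"
    (infixl "square'_integrable'_on" 50) where
  "f square_integrable_on S \<longleftrightarrow>
     f \<in> borel_measurable (lebesgue_on S) \<and>
     integrable (lebesgue_on S) (\<lambda>s. (cmod (f s))\<^sup>2)"

text \<open>\<open>\<phi>\<close> lies in $C^1_c(a,b)$ and has derivative \<open>\<phi>'\<close>.\<close>

definition test_function :: "real \<Rightarrow> real \<Rightarrow> (real \<Rightarrow> real) \<Rightarrow> (real \<Rightarrow> real) \<Rightarrow> bool" where
  "test_function a b \<phi> \<phi>' \<longleftrightarrow>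
     (\<forall>x. (\<phi> has_real_derivative \<phi>' x) (at x)) \<and> continuous_on UNIV \<phi>' \<and>
     (\<exists>K. compact K \<and> K \<subseteq> {a<..<b} \<and> (\<forall>x. x \<notin> K \<longrightarrow> \<phi> x = 0))"

text \<open>\<open>g\<close> belongs to $H^1([0,T])$ and \<open>g'\<close> is a representative of its weak derivative.
  As usual in one dimension, \<open>g\<close> is taken to be the continuous representative of its class,
  so that point values such as \<open>g 0\<close> make sense; \<open>g'\<close> is determined only up to null sets.\<close>

definition H1_with_derivative :: "real \<Rightarrow> (real \<Rightarrow> complex) \<Rightarrow> (real \<Rightarrow> complex) \<Rightarrow> bool" where
  "H1_with_derivative T g g' \<longleftrightarrow>
     continuous_on {0..T} g \<and>
     g square_integrable_on {0..T} \<and> g' square_integrable_on {0..T} \<and>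
     (\<forall>\<phi> \<phi>'. test_function 0 T \<phi> \<phi>' \<longrightarrow>
        (LINT s|lebesgue_on {0..T}. g s * complex_of_real (\<phi>' s)) =
        - (LINT s|lebesgue_on {0..T}. g' s * complex_of_real (\<phi> s)))"

definition \<omega> :: "complex \<Rightarrow> complex" where
  "\<omega> k = - (k ^ 3)"

text \<open>For \<open>r > R\<close>, the part in $\{|k| < r\}$ of the boundary of
  $D_1^+ = \{k : \pi/3 \le \arg k \le 2\pi/3, |k| \ge R\}$, with $D_1^+$ on the left: in along
  the ray $\arg k = 2\pi/3$, clockwise along the arc $|k| = R$, out along $\arg k = \pi/3$.\<close>

definition bdry_D1 :: "real \<Rightarrow> real \<Rightarrow> real \<Rightarrow> complex" where
  "bdry_D1 R r =
     linepath (of_real r * cis (2 * pi / 3)) (of_real R * cis (2 * pi / 3)) +++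
     part_circlepath 0 R (2 * pi / 3) (pi / 3) +++
     linepath (of_real R * cis (pi / 3)) (of_real r * cis (pi / 3))"

definition D1_integral_converges :: "real \<Rightarrow> (complex \<Rightarrow> complex) \<Rightarrow> bool" where
  "D1_integral_converges R f \<longleftrightarrow>
     (\<forall>r>R. f contour_integrable_on bdry_D1 R r) \<and>
     (\<exists>I. ((\<lambda>r. contour_integral (bdry_D1 R r) f) \<longlongrightarrow> I) at_top)"

text \<open>Meaningful only when \<open>D1_integral_converges R f\<close> holds.\<close>

definition D1_integral :: "real \<Rightarrow> (complex \<Rightarrow> complex) \<Rightarrow> complex" where
  "D1_integral R f = Lim at_top (\<lambda>r. contour_integral (bdry_D1 R r) f)"

definition g_tilde :: "(real \<Rightarrow> complex) \<Rightarrow> complex \<Rightarrow> real \<Rightarrow> complex" where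
  "g_tilde g \<kappa> t = (LINT s|lebesgue_on {0..t}. exp (- (\<i> * \<kappa> * of_real s)) * g s)"

definition q_integrand :: "(real \<Rightarrow> complex) \<Rightarrow> real \<Rightarrow> real \<Rightarrow> complex \<Rightarrow> complex" where
  "q_integrand g\<^sub>0 x t k =
     3 * k\<^sup>2 * exp (\<i> * k * of_real x - \<i> * \<omega> k * of_real t) * g_tilde g\<^sub>0 (- \<omega> k) t"

text \<open>The solution of $q_t + q_{xxx} = 0$ for $x > 0$, $0 < t \le T$, with $q(\cdot,0) = 0$ and
  $q(0,\cdot) = g_0$, given by its integral representation (unified transform method).\<close>

definition q_sol :: "real \<Rightarrow> (real \<Rightarrow> complex) \<Rightarrow> real \<Rightarrow> real \<Rightarrow> complex" where
  "q_sol R g\<^sub>0 x t = - (1 / (2 * of_real pi)) * D1_integral R (q_integrand g\<^sub>0 x t)"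

definition I_integrand :: "real \<Rightarrow> real \<Rightarrow> complex \<Rightarrow> complex" where
  "I_integrand x t k = exp (\<i> * k * of_real x - \<i> * \<omega> k * of_real t) * (1 / (\<i> * k))"

definition I_\<omega>_0_1 :: "real \<Rightarrow> real \<Rightarrow> real \<Rightarrow> complex" where
  "I_\<omega>_0_1 R x t = 1 / (2 * of_real pi) * D1_integral R (I_integrand x t)"

definition G_0_0 :: "(real \<Rightarrow> complex) \<Rightarrow> real \<Rightarrow> complex \<Rightarrow> complex" where
  "G_0_0 g\<^sub>0' t k = (LINT s'|lebesgue_on {0..t}. exp (\<i> * \<omega> k * of_real s') * g\<^sub>0' s')"

text \<open>The upper limit \<open>t\<close> in \<open>G_0_0\<close> is the running time of $q(x,t)$, not the limit point \<open>\<tau>\<close>.\<close>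

definition G_integrand ::
    "(real \<Rightarrow> complex) \<Rightarrow> real \<Rightarrow> real \<Rightarrow> real \<Rightarrow> complex \<Rightarrow> complex" where
  "G_integrand g\<^sub>0' t s \<tau> k =
     exp (\<i> * k * of_real s - \<i> * \<omega> k * of_real \<tau>) * G_0_0 g\<^sub>0' t k * (1 / (\<i> * k))"

end

theory Submission
  imports Defs
begin

text \<open>Write \<open>G\<close> for \<open>G_0_0 g\<^sub>0' t\<close>. Integrating by parts in time turns the transform of \<open>g\<^sub>0\<close> in the
integrand of \<open>q\<close> into
\[ 3 k^2 \tilde g_0 = \frac{3}{ik}\bigl(g_0(0) + G(k) - e^{i\omega(k)t} g_0(t)\bigr). \]
The first term is the one with \<open>I_\<omega>_0_1\<close>. The last one contributes $\int e^{ikx}\,dk/(ik)$, which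
is zero for \<open>x > 0\<close>: in the upper half plane, where the integrand is holomorphic, the truncated
contour can be replaced by the horizontal segment between its end points, and this segment moves
off to infinity (\<open>bdry_D1_integral_exp_tendsto_0\<close>). So \<open>q\<close> is given exactly by the claimed formula
with \<open>(s, \<tau>)\<close> replaced by \<open>(x, t)\<close> (\<open>q_sol_representation\<close>), and the error term is the difference
of two integrals with the same \<open>G\<close>, namely that of
\[ \bigl(e^{ikx-i\omega(k)t} - e^{iks-i\omega(k)\tau}\bigr)\, G(k) / (ik). \]

On both rays $k = \rho c$ with $c^3 = \mp 1$, so $e^{-i\omega(k)t}$ has modulus one and $G$ is a Fourier
transform of $g_0' 1_{[0,t]}$ at the frequency $\pm\rho^3$. The bracket is at most
$\rho\,(|x-s| + 2|t-\tau|^{1/3})$ (\<open>norm_exponential_diff_ray_le\<close>), hence everything reduces to a bound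
for $\int_R^\infty |G(\rho c)|\,d\rho$ that is uniform in \<open>t\<close>. Such a bound follows from
$|G| \le 3\rho^2|G|^2 + \rho^{-2}$, the substitution $w = \rho^3$, and
$\int |G|^2\,dw \le 2\pi\,\|g_0'\|_{L^2}^2$. The last inequality is half of Plancherel's theorem; for a
function supported in an interval of length \<open>t\<close> it is Bessel's inequality for the orthogonal system
$e^{i(\theta + 2\pi n/t)s}$, integrated over $\theta$ in a period (\<open>expint_L2_bound\<close>). The arc $|k| = R$ is
compact and gives a Lipschitz contribution. In total the error is
$O(|x-s| + |t-\tau|^{1/3} + |t-\tau|)$, which near \<open>(s, \<tau>)\<close> is stronger than the stated rate.\<close>

section \<open>Integration by parts for functions in $H^1$\<close>

lemma has_real_derivative_truncated_square:
  "((\<lambda>y. (max 0 y)\<^sup>2) has_real_derivative 2 * max 0 x) (at (x::real))"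
proof -
  consider "x > 0" | "x < 0" | "x = 0" by linarith
  then show ?thesis
  proof cases
    case 1
    have "((\<lambda>y. y\<^sup>2) has_real_derivative 2 * max 0 x) (at x)"
      using 1 by (auto intro!: derivative_eq_intros)
    then show ?thesis
      by (rule has_field_derivative_transform_within_open[of _ _ _ "{0<..}"]) (use 1 in auto)
  next
    case 2
    have "((\<lambda>y. 0) has_real_derivative 2 * max 0 x) (at x)"
      using 2 by auto
    then show ?thesis
      by (rule has_field_derivative_transform_within_open[of _ _ _ "{..<0}"]) (use 2 in auto)
  next
    case 3
    have "((\<lambda>h. ((max 0 (x + h))\<^sup>2 - (max 0 x)\<^sup>2) / h) \<longlongrightarrow> 0) (at 0)"
    proof (rule Lim_transform_eventually)
      show "((\<lambda>h::real. max 0 h) \<longlongrightarrow> 0) (at 0)"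
        by (auto intro!: tendsto_eq_intros)
      show "\<forall>\<^sub>F h in at 0. max 0 h = ((max 0 (x + h))\<^sup>2 - (max 0 x)\<^sup>2) / h"
        using 3 by (auto simp: eventually_at_filter power2_eq_square max_def)
    qed
    then show ?thesis using 3 by (simp add: DERIV_def)
  qed
qed

text \<open>A quadratic spline with hat-shaped derivative. Its dilations and reflections cut a smooth function
off near the end points of an interval, which makes it an admissible test function.\<close>

lemma exists_C1_step:
  obtains \<psi> \<psi>' :: "real \<Rightarrow> real" where
    "\<And>y. (\<psi> has_real_derivative \<psi>' y) (at y)" "continuous_on UNIV \<psi>'"
    "\<And>y. y \<le> 1 \<Longrightarrow> \<psi> y = 0" "\<And>y. y \<ge> 2 \<Longrightarrow> \<psi> y = 1"
    "\<And>y. 0 \<le> \<psi> y" "\<And>y. \<psi> y \<le> 1" "\<And>y. 0 \<le> \<psi>' y" "\<And>y. y \<le> 1 \<Longrightarrow> \<psi>' y = 0" "\<And>y. y \<ge> 2 \<Longrightarrow> \<psi>' y = 0"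
proof -
  define \<psi> \<psi>' :: "real \<Rightarrow> real" where
    "\<psi> y = 2 * (max 0 (y - 1))\<^sup>2 - 4 * (max 0 (y - 3/2))\<^sup>2 + 2 * (max 0 (y - 2))\<^sup>2" and
    "\<psi>' y = 4 * max 0 (y - 1) - 8 * max 0 (y - 3/2) + 4 * max 0 (y - 2)" for y
  have sq: "((\<lambda>y. (max 0 (y - a))\<^sup>2) has_real_derivative 2 * max 0 (y - a)) (at y)" for a y :: real
    using DERIV_chain2[OF has_real_derivative_truncated_square DERIV_diff[OF DERIV_ident DERIV_const]]
    by simp
  have d: "(\<psi> has_real_derivative \<psi>' y) (at y)" for y
    unfolding \<psi>_def \<psi>'_def by (rule derivative_eq_intros sq refl | simp)+
  have c: "continuous_on UNIV \<psi>'" unfolding \<psi>'_def by (intro continuous_intros)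
  have z: "\<psi> y = 0" if "y \<le> 1" for y using that by (simp add: \<psi>_def)
  have o: "\<psi> y = 1" if "y \<ge> 2" for y
    using that by (simp add: \<psi>_def power2_eq_square algebra_simps)
  have p: "0 \<le> \<psi>' y" for y by (simp add: \<psi>'_def max_def)
  have m: "\<psi> x \<le> \<psi> y" if "x \<le> y" for x y
    using DERIV_nonneg_imp_nondecreasing[OF that, of \<psi>] d p by blast
  have lo: "0 \<le> \<psi> y" for y using m[of "min y 1" y] z[of "min y 1"] by simp
  have hi: "\<psi> y \<le> 1" for y using m[of y "max y 2"] o[of "max y 2"] by simp
  have l: "\<psi>' y = 0" if "y \<le> 1" for y using that by (simp add: \<psi>'_def)
  have r: "\<psi>' y = 0" if "y \<ge> 2" for y using that by (simp add: \<psi>'_def)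
  show ?thesis by (rule that[OF d c z o lo hi p l r])
qed

text \<open>The derivative of the cutoff at scale \<open>1 / n\<close> is a unit mass concentrating at \<open>0\<close>; this is how
boundary values emerge from the weak formulation.\<close>

lemma tendsto_integral_approximate_identity:
  fixes v :: "real \<Rightarrow> complex"
  assumes t: "t > 0" and v: "continuous_on {0..t} v"
    and d: "\<And>y. (\<psi> has_real_derivative \<psi>' y) (at y)" and c: "continuous_on UNIV \<psi>'"
    and z: "\<psi> 0 = 0" and o: "\<And>y. y \<ge> 2 \<Longrightarrow> \<psi> y = 1"
    and p: "\<And>y. 0 \<le> \<psi>' y" and s: "\<And>y. y \<ge> 2 \<Longrightarrow> \<psi>' y = 0"
  shows "(\<lambda>n. integral {0..t} (\<lambda>s. v s * complex_of_real (real n * \<psi>' (real n * s)))) \<longlonglongrightarrow> v 0"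
proof (rule LIMSEQ_I)
  fix e :: real assume e: "e > 0"
  have "\<exists>\<delta>>0. \<forall>x\<in>{0..t}. dist x 0 < \<delta> \<longrightarrow> dist (v x) (v 0) < e / 2"
    using v[unfolded continuous_on_iff, THEN bspec[of _ _ 0], THEN spec[of _ "e/2"]] t e by simp
  then obtain \<delta> where \<delta>: "\<delta> > 0" "\<And>x. x \<in> {0..t} \<Longrightarrow> x < \<delta> \<Longrightarrow> norm (v x - v 0) < e / 2"
    by (auto simp: dist_norm)
  obtain N :: nat where N: "real N > 2 / \<delta>" "real N > 2 / t"
    using reals_Archimedean2[of "max (2 / \<delta>) (2 / t)"] by auto
  show "\<exists>no. \<forall>n\<ge>no. norm (integral {0..t} (\<lambda>s. v s * complex_of_real (real n * \<psi>' (real n * s))) - v 0) < e"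
  proof (intro exI allI impI)
    fix n assume "n \<ge> N"
    then have n: "real n > 2 / \<delta>" "real n > 2 / t" using N by linarith+
    then have n2: "real n * \<delta> > 2" "real n * t > 2" using t \<delta> by (auto simp: field_simps)
    have cn: "continuous_on A (\<lambda>s. real n * \<psi>' (real n * s))" for A
      by (intro continuous_intros continuous_on_compose2[OF c]) auto
    have dn: "((\<lambda>s. \<psi> (real n * s)) has_vector_derivative real n * \<psi>' (real n * s)) (at s within {0..t})" for s
      unfolding has_real_derivative_iff_has_vector_derivative[symmetric]
      by (rule has_field_derivative_at_within, rule DERIV_chain2[OF d, THEN DERIV_cong])
         (rule derivative_eq_intros refl | simp)+
    have I: "((\<lambda>s. real n * \<psi>' (real n * s)) has_integral 1) {0..t}"
      using fundamental_theorem_of_calculus[OF less_imp_le[OF t] dn] z o[of "real n * t"] n2 by simp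
    have "((\<lambda>s. complex_of_real (real n * \<psi>' (real n * s))) has_integral 1) {0..t}"
      using has_integral_of_real[OF I] by simp
    then have I0: "((\<lambda>s. v 0 * complex_of_real (real n * \<psi>' (real n * s))) has_integral v 0) {0..t}"
      using has_integral_mult_right[of _ 1 _ "v 0"] by simp
    have i1: "(\<lambda>s. v s * complex_of_real (real n * \<psi>' (real n * s))) integrable_on {0..t}"
      by (intro integrable_continuous_real continuous_intros v cn continuous_on_of_real)
    have eq: "integral {0..t} (\<lambda>s. v s * complex_of_real (real n * \<psi>' (real n * s))) - v 0
      = integral {0..t} (\<lambda>s. (v s - v 0) * complex_of_real (real n * \<psi>' (real n * s)))"
      using integral_diff[OF i1 has_integral_integrable[OF I0]] integral_unique[OF I0]
      by (simp add: left_diff_distrib)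
    have "norm (integral {0..t} (\<lambda>s. (v s - v 0) * complex_of_real (real n * \<psi>' (real n * s))))
        \<le> integral {0..t} (\<lambda>s. (e / 2) * (real n * \<psi>' (real n * s)))"
    proof (rule integral_norm_bound_integral)
      show "(\<lambda>s. (v s - v 0) * complex_of_real (real n * \<psi>' (real n * s))) integrable_on {0..t}"
        by (intro integrable_continuous_real continuous_intros v cn continuous_on_of_real)
      show "(\<lambda>s. (e / 2) * (real n * \<psi>' (real n * s))) integrable_on {0..t}"
        by (intro integrable_continuous_real continuous_intros continuous_on_compose2[OF c]) auto
      fix x assume x: "x \<in> {0..t}"
      show "norm ((v x - v 0) * complex_of_real (real n * \<psi>' (real n * x))) \<le> (e / 2) * (real n * \<psi>' (real n * x))"
      proof (cases "x < \<delta>")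
        case True
        have "norm (v x - v 0) * (real n * \<psi>' (real n * x)) \<le> (e / 2) * (real n * \<psi>' (real n * x))"
          using \<delta>(2)[OF x True] p[of "real n * x"] by (intro mult_right_mono) auto
        then show ?thesis using p[of "real n * x"] by (simp add: norm_mult)
      next
        case False
        then have "real n * x \<ge> real n * \<delta>" by (intro mult_left_mono) auto
        then show ?thesis using s[of "real n * x"] n2 by simp
      qed
    qed
    also have "\<dots> = e / 2" using integral_unique[OF has_integral_mult_right[OF I]] by simp
    finally show "norm (integral {0..t} (\<lambda>s. v s * complex_of_real (real n * \<psi>' (real n * s))) - v 0) < e"
      using e unfolding eq by simp
  qed
qed

lemma integrable_mult_continuous:
  fixes h f :: "real \<Rightarrow> complex"
  assumes h: "integrable (lebesgue_on {a..b}) h" and f: "continuous_on {a..b} f"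
  shows "integrable (lebesgue_on {a..b}) (\<lambda>s. h s * f s)"
proof -
  obtain B where B: "\<And>s. s \<in> {a..b} \<Longrightarrow> norm (f s) \<le> B"
    using compact_imp_bounded[OF compact_continuous_image[OF f compact_Icc]]
    unfolding bounded_iff by blast
  show ?thesis
  proof (rule Bochner_Integration.integrable_bound)
    show "integrable (lebesgue_on {a..b}) (\<lambda>s. h s * of_real B)" using h by simp
    show "(\<lambda>s. h s * f s) \<in> borel_measurable (lebesgue_on {a..b})"
      using h continuous_imp_measurable_on_sets_lebesgue[OF f] by (auto intro: borel_measurable_times)
    show "AE s in lebesgue_on {a..b}. norm (h s * f s) \<le> norm (h s * of_real B)"
    proof (rule AE_I2)
      fix s assume "s \<in> space (lebesgue_on {a..b})"
      then have "norm (f s) \<le> \<bar>B\<bar>" using B[of s] by auto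
      then show "norm (h s * f s) \<le> norm (h s * of_real B)"
        by (simp add: norm_mult mult_left_mono)
    qed
  qed
qed

lemma square_integrable_imp_integrable:
  assumes "f square_integrable_on {a..b}"
  shows "integrable (lebesgue_on {a..b}) f"
proof (rule Bochner_Integration.integrable_bound)
  show "integrable (lebesgue_on {a..b}) (\<lambda>s. 1 + (cmod (f s))\<^sup>2)"
    using assms unfolding square_integrable_on_def
    by (intro Bochner_Integration.integrable_add[OF continuous_imp_integrable_real])
       auto
  show "f \<in> borel_measurable (lebesgue_on {a..b})"
    using assms by (simp add: square_integrable_on_def)
  have "y \<le> 1 + y\<^sup>2" for y :: real
    using zero_le_power2[of "y - 1"] zero_le_power2[of y] unfolding power2_diff by (simp; linarith)
  then show "AE x in lebesgue_on {a..b}. norm (f x) \<le> norm (1 + (cmod (f x))\<^sup>2)" by simp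
qed

lemma square_integrable_on_subset:
  assumes "f square_integrable_on {a..b}" "{c..d} \<subseteq> {a..b}"
  shows "f square_integrable_on {c..d}"
  unfolding square_integrable_on_def
proof
  show "f \<in> borel_measurable (lebesgue_on {c..d})"
    by (rule measurable_restrict_mono[OF _ assms(2)])
       (use assms(1) in \<open>simp add: square_integrable_on_def\<close>)
  have "set_integrable lebesgue {a..b} (\<lambda>s. (cmod (f s))\<^sup>2)"
    using assms(1) by (simp add: square_integrable_on_def set_integrable_def integrable_restrict_space)
  then have "set_integrable lebesgue {c..d} (\<lambda>s. (cmod (f s))\<^sup>2)"
    by (rule set_integrable_subset) (use assms(2) in auto)
  then show "integrable (lebesgue_on {c..d}) (\<lambda>s. (cmod (f s))\<^sup>2)"
    by (simp add: set_integrable_def integrable_restrict_space)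
qed

lemma lebesgue_on_integral_vanishing_beyond:
  fixes f :: "real \<Rightarrow> complex"
  assumes "t \<le> T" "\<And>s. t < s \<Longrightarrow> f s = 0"
  shows "(LINT s|lebesgue_on {0..T}. f s) = (LINT s|lebesgue_on {0..t}. f s)"
proof -
  have "indicator {0..T} s *\<^sub>R f s = indicator {0..t} s *\<^sub>R f s" for s
    using assms by (cases "t < s") (auto simp: indicator_def)
  then have "(\<lambda>s. indicator {0..T} s *\<^sub>R f s) = (\<lambda>s. indicator {0..t} s *\<^sub>R f s)" by blast
  then show ?thesis by (subst (1 2) integral_restrict_space) simp_all
qed

lemma integral_reflection:
  fixes f :: "real \<Rightarrow> complex"
  shows "integral {0..t} (\<lambda>s. f (t - s)) = integral {0..t} f"
  using integral_shift_real_ivl[of "-t" "-t" 0 "\<lambda>x. f (- x)"] Henstock_Kurzweil_Integration.integral_reflect_real[of t 0 f] by simp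

lemma AE_lebesgue_on_interior:
  "AE s in lebesgue_on {a..b::real}. s \<in> {a<..<b}"
proof -
  have "AE s in lebesgue. s \<noteq> c" for c :: real
    by (rule AE_completion[OF AE_lborel_singleton])
  from this[of a] this[of b] have "AE s in lebesgue. s \<in> {a..b} \<longrightarrow> s \<in> {a<..<b}"
    by eventually_elim auto
  then show ?thesis by (subst AE_restrict_space_iff) auto
qed

text \<open>Test the weak derivative with \<open>u\<close> times a cutoff that vanishes near \<open>0\<close> and \<open>t\<close> and let the width of
the cutoff layers tend to zero. The terms in which the cutoff is not differentiated converge by
dominated convergence; its derivative produces the two boundary values. Taking the cutoff on
\<open>[0, t]\<close> instead of \<open>[0, T]\<close> gives the formula for every intermediate time.\<close>

lemma weak_integration_by_parts_real:
  fixes u u' :: "real \<Rightarrow> real"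
  assumes H: "H1_with_derivative T g g'" and t: "0 < t" "t \<le> T"
    and du: "\<And>s. (u has_real_derivative u' s) (at s)" and cu': "continuous_on UNIV u'"
  shows "(LINT s|lebesgue_on {0..t}. g s * of_real (u' s)) + (LINT s|lebesgue_on {0..t}. g' s * of_real (u s))
     = g t * of_real (u t) - g 0 * of_real (u 0)"
proof -
  obtain \<psi> \<psi>' :: "real \<Rightarrow> real" where d: "\<And>y. (\<psi> has_real_derivative \<psi>' y) (at y)"
    and c: "continuous_on UNIV \<psi>'"
    and z: "\<And>y. y \<le> 1 \<Longrightarrow> \<psi> y = 0" and o: "\<And>y. y \<ge> 2 \<Longrightarrow> \<psi> y = 1"
    and b: "\<And>y. 0 \<le> \<psi> y" "\<And>y. \<psi> y \<le> 1"
    and p: "\<And>y. 0 \<le> \<psi>' y" "\<And>y. y \<le> 1 \<Longrightarrow> \<psi>' y = 0" "\<And>y. y \<ge> 2 \<Longrightarrow> \<psi>' y = 0"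
    by (rule exists_C1_step) (rule that, assumption+)
  define \<eta> where "\<eta> n s = \<psi> (real n * s) + \<psi> (real n * (t - s)) - 1" for n s
  define \<eta>' where "\<eta>' n s = real n * \<psi>' (real n * s) - real n * \<psi>' (real n * (t - s))" for n s
  have c0: "continuous_on UNIV \<psi>" using d DERIV_continuous_on by blast
  have cu: "continuous_on UNIV u" using du DERIV_continuous_on by blast
  have c\<eta>: "continuous_on S (\<eta> n)" for S n unfolding \<eta>_def
    by (intro continuous_intros continuous_on_compose2[OF c0]) auto
  have c\<eta>': "continuous_on S (\<eta>' n)" for S n unfolding \<eta>'_def
    by (intro continuous_intros continuous_on_compose2[OF c]) auto
  have cug: "continuous_on S u" "continuous_on S u'" for S
    using cu cu' continuous_on_subset by blast+
  have cg: "continuous_on {0..t} g"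
    using H t continuous_on_subset unfolding H1_with_derivative_def by fastforce
  have d1: "((\<lambda>s. \<psi> (real n * s)) has_real_derivative real n * \<psi>' (real n * s)) (at s)" for n s
    by (rule DERIV_chain2[OF d, THEN DERIV_cong]) (rule derivative_eq_intros refl | simp)+
  have d2: "((\<lambda>s. \<psi> (real n * (t - s))) has_real_derivative - (real n * \<psi>' (real n * (t - s)))) (at s)" for n s
    by (rule DERIV_chain2[OF d, THEN DERIV_cong]) (rule derivative_eq_intros refl | simp)+
  have d\<eta>: "(\<eta> n has_real_derivative \<eta>' n s) (at s)" for n s
    unfolding \<eta>_def \<eta>'_def by (rule derivative_eq_intros d1 d2 refl | simp)+
  have ig: "integrable (lebesgue_on {0..t}) g"
    using cg by (rule continuous_imp_integrable_real)
  have ig': "integrable (lebesgue_on {0..t}) g'"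
    by (rule square_integrable_imp_integrable[OF square_integrable_on_subset])
       (use H t in \<open>auto simp: H1_with_derivative_def\<close>)
  have lim\<eta>: "(\<lambda>n. LINT s|lebesgue_on {0..t}. h s * of_real (\<eta> n s)) \<longlonglongrightarrow> (LINT s|lebesgue_on {0..t}. h s)"
    if h: "integrable (lebesgue_on {0..t}) h" for h :: "real \<Rightarrow> complex"
  proof (rule integral_dominated_convergence)
    show "h \<in> borel_measurable (lebesgue_on {0..t})" using h by auto
    show "integrable (lebesgue_on {0..t}) (\<lambda>s. norm (h s))" using h by simp
    show "(\<lambda>s. h s * of_real (\<eta> n s)) \<in> borel_measurable (lebesgue_on {0..t})" for n
      using integrable_mult_continuous[OF h continuous_on_of_real[OF c\<eta>]] by auto
    show "AE s in lebesgue_on {0..t}. norm (h s * of_real (\<eta> n s)) \<le> norm (h s)" for n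
    proof (rule AE_I2)
      fix s
      have "\<bar>\<eta> n s\<bar> \<le> 1" using b[of "real n * s"] b[of "real n * (t - s)"] by (simp add: \<eta>_def abs_le_iff)
      then show "norm (h s * of_real (\<eta> n s)) \<le> norm (h s)"
        by (simp add: norm_mult mult_left_le)
    qed
    show "AE s in lebesgue_on {0..t}. (\<lambda>n. h s * of_real (\<eta> n s)) \<longlonglongrightarrow> h s"
      using AE_lebesgue_on_interior
    proof eventually_elim
      case (elim s)
      obtain N :: nat where N: "real N > 2 / s" "real N > 2 / (t - s)"
        using reals_Archimedean2[of "max (2 / s) (2 / (t - s))"] by auto
      have "\<eta> n s = 1" if "n \<ge> N" for n
      proof -
        have "real n > 2 / s" "real n > 2 / (t - s)" using N that by linarith+
        then have "real n * s \<ge> 2" "real n * (t - s) \<ge> 2" using elim by (auto simp: field_simps)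
        then show ?thesis by (simp add: \<eta>_def o)
      qed
      then show ?case by (intro tendsto_eventually) (auto simp: eventually_sequentially)
    qed
  qed
  define v where "v s = g s * of_real (u s)" for s
  have cv: "continuous_on {0..t} v" unfolding v_def by (intro continuous_intros cg cug continuous_on_of_real)
  have L1: "(\<lambda>n. integral {0..t} (\<lambda>s. v s * of_real (real n * \<psi>' (real n * s)))) \<longlonglongrightarrow> v 0"
    by (rule tendsto_integral_approximate_identity[OF t(1) cv d c]) (use z o p in auto)
  \<comment> \<open>The cutoff layer at \<open>t\<close> is the reflection of the one at \<open>0\<close>.\<close>
  have "(\<lambda>n. integral {0..t} (\<lambda>s. v (t - s) * of_real (real n * \<psi>' (real n * s)))) \<longlonglongrightarrow> v (t - 0)"
    by (rule tendsto_integral_approximate_identity[OF t(1) _ d c])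
       (use z o p in \<open>auto intro!: continuous_intros continuous_on_compose2[OF cv]\<close>)
  moreover have "integral {0..t} (\<lambda>s. v (t - s) * of_real (real n * \<psi>' (real n * s)))
      = integral {0..t} (\<lambda>s. v s * of_real (real n * \<psi>' (real n * (t - s))))" for n
    using integral_reflection[of t "\<lambda>s. v s * of_real (real n * \<psi>' (real n * (t - s)))"] by simp
  ultimately have L2: "(\<lambda>n. integral {0..t} (\<lambda>s. v s * of_real (real n * \<psi>' (real n * (t - s))))) \<longlonglongrightarrow> v t"
    by simp
  obtain N :: nat where N: "real N > 4 / t" using reals_Archimedean2 by blast
  have key: "(LINT s|lebesgue_on {0..t}. (g s * of_real (u' s)) * of_real (\<eta> n s))
     + integral {0..t} (\<lambda>s. v s * of_real (real n * \<psi>' (real n * s)))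
     - integral {0..t} (\<lambda>s. v s * of_real (real n * \<psi>' (real n * (t - s))))
     = - (LINT s|lebesgue_on {0..t}. (g' s * of_real (u s)) * of_real (\<eta> n s))" if "n \<ge> N" for n
  proof -
    have nt: "real n * t > 4" "real n > 0"
    proof -
      have "real n > 4 / t" using N that by linarith
      then show "real n * t > 4" using t by (simp add: field_simps)
      have "4 / t > 0" using t by simp
      then show "real n > 0" using \<open>real n > 4 / t\<close> by linarith
    qed
    \<comment> \<open>For \<open>n t > 4\<close> the two layers are disjoint, so \<open>\<eta>\<close> has compact support inside \<open>(0, t)\<close>.\<close>
    have out: "\<eta> n s = 0 \<and> \<eta>' n s = 0" if "s \<notin> {1 / real n..t - 1 / real n}" for s
    proof -
      have "s < 1 / real n \<or> t - s < 1 / real n"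
        using that unfolding atLeastAtMost_iff by linarith
      then consider "s < 1 / real n" | "t - s < 1 / real n" by blast
      then show ?thesis
      proof cases
        case 1
        then have 1: "real n * s < 1" using nt by (simp add: field_simps)
        then have "real n * (t - s) \<ge> 2" using nt by (simp add: algebra_simps)
        then show ?thesis using 1 by (simp add: \<eta>_def \<eta>'_def z o p)
      next
        case 2
        then have 2: "real n * (t - s) < 1" using nt by (simp add: field_simps)
        then have "real n * s \<ge> 2" using nt by (simp add: algebra_simps)
        then show ?thesis using 2 by (simp add: \<eta>_def \<eta>'_def z o p)
      qed
    qed
    define \<phi> where "\<phi> s = u s * \<eta> n s" for s
    define \<phi>' where "\<phi>' s = u' s * \<eta> n s + u s * \<eta>' n s" for s
    have "test_function 0 T \<phi> \<phi>'"
      unfolding test_function_def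
    proof (intro conjI allI exI[of _ "{1 / real n..t - 1 / real n}"] impI)
      show "(\<phi> has_real_derivative \<phi>' x) (at x)" for x
        unfolding \<phi>_def \<phi>'_def by (rule derivative_eq_intros du d\<eta> refl | simp)+
      show "continuous_on UNIV \<phi>'" unfolding \<phi>'_def by (intro continuous_intros cug c\<eta> c\<eta>')
      show "{1 / real n..t - 1 / real n} \<subseteq> {0<..<T}"
      proof
        fix x assume x: "x \<in> {1 / real n..t - 1 / real n}"
        have "1 / real n > 0" using nt by simp
        then show "x \<in> {0<..<T}" using x t unfolding atLeastAtMost_iff greaterThanLessThan_iff by linarith
      qed
    qed (auto simp: \<phi>_def out)
    then have "(LINT s|lebesgue_on {0..T}. g s * of_real (\<phi>' s)) = - (LINT s|lebesgue_on {0..T}. g' s * of_real (\<phi> s))"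
      using H unfolding H1_with_derivative_def by blast
    moreover have "\<phi> s = 0 \<and> \<phi>' s = 0" if "t < s" for s
    proof -
      have "1 / real n > 0" using nt by simp
      then have "s \<notin> {1 / real n..t - 1 / real n}"
        using that unfolding atLeastAtMost_iff by linarith
      then show ?thesis using out unfolding \<phi>_def \<phi>'_def by simp
    qed
    ultimately have eq: "(LINT s|lebesgue_on {0..t}. g s * of_real (\<phi>' s)) = - (LINT s|lebesgue_on {0..t}. g' s * of_real (\<phi> s))"
      using lebesgue_on_integral_vanishing_beyond[OF t(2), of "\<lambda>s. g s * of_real (\<phi>' s)"]
        lebesgue_on_integral_vanishing_beyond[OF t(2), of "\<lambda>s. g' s * of_real (\<phi> s)"] by simp
    have i1: "integrable (lebesgue_on {0..t}) (\<lambda>s. (g s * of_real (u' s)) * of_real (\<eta> n s))"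
      by (intro integrable_mult_continuous ig continuous_on_of_real cug c\<eta>)
    have i2: "integrable (lebesgue_on {0..t}) (\<lambda>s. v s * of_real (real n * \<psi>' (real n * s)))"
      by (intro continuous_imp_integrable_real continuous_intros cv continuous_on_of_real continuous_on_compose2[OF c]) auto
    have i3: "integrable (lebesgue_on {0..t}) (\<lambda>s. v s * of_real (real n * \<psi>' (real n * (t - s))))"
      by (intro continuous_imp_integrable_real continuous_intros cv continuous_on_of_real continuous_on_compose2[OF c]) auto
    have "(LINT s|lebesgue_on {0..t}. g s * of_real (\<phi>' s)) = (LINT s|lebesgue_on {0..t}. (g s * of_real (u' s)) * of_real (\<eta> n s)
        + v s * of_real (real n * \<psi>' (real n * s)) - v s * of_real (real n * \<psi>' (real n * (t - s))))"
      by (intro Bochner_Integration.integral_cong refl) (simp add: \<phi>'_def \<eta>'_def v_def algebra_simps)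
    also have "\<dots> = (LINT s|lebesgue_on {0..t}. (g s * of_real (u' s)) * of_real (\<eta> n s))
     + integral {0..t} (\<lambda>s. v s * of_real (real n * \<psi>' (real n * s)))
     - integral {0..t} (\<lambda>s. v s * of_real (real n * \<psi>' (real n * (t - s))))"
      using i1 i2 i3 lebesgue_integral_eq_integral[OF i2] lebesgue_integral_eq_integral[OF i3] by simp
    finally show ?thesis using eq by (simp add: \<phi>_def mult.assoc)
  qed
  have "(\<lambda>n. (LINT s|lebesgue_on {0..t}. (g s * of_real (u' s)) * of_real (\<eta> n s))
     + integral {0..t} (\<lambda>s. v s * of_real (real n * \<psi>' (real n * s)))
     - integral {0..t} (\<lambda>s. v s * of_real (real n * \<psi>' (real n * (t - s)))))
     \<longlonglongrightarrow> (LINT s|lebesgue_on {0..t}. (g s * of_real (u' s))) + v 0 - v t"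
    by (intro tendsto_intros L1 L2 lim\<eta> integrable_mult_continuous ig continuous_on_of_real cug)
  moreover have "(\<lambda>n. - (LINT s|lebesgue_on {0..t}. (g' s * of_real (u s)) * of_real (\<eta> n s)))
     \<longlonglongrightarrow> - (LINT s|lebesgue_on {0..t}. (g' s * of_real (u s)))"
    by (intro tendsto_intros lim\<eta> integrable_mult_continuous ig' continuous_on_of_real cug)
  ultimately have "(LINT s|lebesgue_on {0..t}. (g s * of_real (u' s))) + v 0 - v t = - (LINT s|lebesgue_on {0..t}. (g' s * of_real (u s)))"
    using key by (intro LIMSEQ_unique[OF Lim_transform_eventually]) (auto simp: eventually_sequentially)
  then show ?thesis unfolding v_def by (metis (no_types, lifting) add.commute add_diff_eq diff_eq_eq diff_minus_eq_add)
qed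

lemma weak_integration_by_parts:
  fixes e e' :: "real \<Rightarrow> complex"
  assumes H: "H1_with_derivative T g g'" and t: "0 < t" "t \<le> T"
    and de: "\<And>s. (e has_vector_derivative e' s) (at s)" and ce': "continuous_on UNIV e'"
  shows "(LINT s|lebesgue_on {0..t}. g s * e' s) + (LINT s|lebesgue_on {0..t}. g' s * e s)
     = g t * e t - g 0 * e 0"
proof -
  have ce: "continuous_on UNIV e"
    by (rule continuous_on_vector_derivative) (use de in simp)
  have cg: "continuous_on {0..t} g"
    using H t continuous_on_subset unfolding H1_with_derivative_def by fastforce
  have ig: "integrable (lebesgue_on {0..t}) g"
    using cg by (rule continuous_imp_integrable_real)
  have ig': "integrable (lebesgue_on {0..t}) g'"
    by (rule square_integrable_imp_integrable[OF square_integrable_on_subset])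
       (use H t in \<open>auto simp: H1_with_derivative_def\<close>)
  have split: "(LINT s|lebesgue_on {0..t}. h s * f s)
      = (LINT s|lebesgue_on {0..t}. h s * of_real (Re (f s))) + \<i> * (LINT s|lebesgue_on {0..t}. h s * of_real (Im (f s)))"
    if h: "integrable (lebesgue_on {0..t}) h" and f: "continuous_on UNIV f" for h f :: "real \<Rightarrow> complex"
  proof -
    have f': "continuous_on {0..t} f" using f continuous_on_subset by blast
    have 1: "integrable (lebesgue_on {0..t}) (\<lambda>s. h s * of_real (Re (f s)))"
      "integrable (lebesgue_on {0..t}) (\<lambda>s. h s * of_real (Im (f s)))"
      by (intro integrable_mult_continuous h continuous_intros f')+
    have "(LINT s|lebesgue_on {0..t}. h s * f s) =
       (LINT s|lebesgue_on {0..t}. h s * of_real (Re (f s)) + \<i> * (h s * of_real (Im (f s))))"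
    proof (intro Bochner_Integration.integral_cong refl)
      fix s
      have "h s * (of_real (Re (f s)) + \<i> * of_real (Im (f s))) = h s * of_real (Re (f s)) + \<i> * (h s * of_real (Im (f s)))"
        by (simp only: distrib_left mult.left_commute)
      then show "h s * f s = h s * of_real (Re (f s)) + \<i> * (h s * of_real (Im (f s)))"
        by (simp only: complex_eq[symmetric])
    qed
    then show ?thesis using 1 by simp
  qed
  have R: "((\<lambda>s. Re (e s)) has_real_derivative Re (e' s)) (at s)"
    and I: "((\<lambda>s. Im (e s)) has_real_derivative Im (e' s)) (at s)" for s
    using bounded_linear.has_vector_derivative[OF bounded_linear_Re de]
      bounded_linear.has_vector_derivative[OF bounded_linear_Im de]
    by (simp_all add: has_real_derivative_iff_has_vector_derivative)
  have "(LINT s|lebesgue_on {0..t}. g s * e' s) + (LINT s|lebesgue_on {0..t}. g' s * e s)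
    = (g t * of_real (Re (e t)) - g 0 * of_real (Re (e 0))) + \<i> * (g t * of_real (Im (e t)) - g 0 * of_real (Im (e 0)))"
    unfolding split[OF ig ce'] split[OF ig' ce]
      weak_integration_by_parts_real[OF H t R continuous_on_Re[OF ce'], symmetric]
      weak_integration_by_parts_real[OF H t I continuous_on_Im[OF ce'], symmetric]
    by (simp only: distrib_left add.assoc add.left_commute)
  also have "\<dots> = g t * (of_real (Re (e t)) + \<i> * of_real (Im (e t))) - g 0 * (of_real (Re (e 0)) + \<i> * of_real (Im (e 0)))"
    by (simp only: distrib_left right_diff_distrib mult.left_commute[of _ \<i>]) simp
  finally show ?thesis by (simp only: complex_eq[symmetric])
qed

section \<open>The truncated exponential transform\<close>

text \<open>Both \<open>g_tilde\<close> and \<open>G_0_0\<close> are values of this truncated exponential transform at \<open>z = \<i> * \<omega> k\<close>.\<close>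

definition expint :: "real \<Rightarrow> (real \<Rightarrow> complex) \<Rightarrow> complex \<Rightarrow> complex" where
  "expint t h z = (LINT s|lebesgue_on {0..t}. exp (z * of_real s) * h s)"

lemma integrable_expint:
  fixes h :: "real \<Rightarrow> complex"
  assumes "integrable (lebesgue_on {0..t}) h"
  shows "integrable (lebesgue_on {0..t}) (\<lambda>s. exp (z * of_real s) * h s)"
  using integrable_mult_continuous[OF assms, of "\<lambda>s. exp (z * of_real s)"]
  by (simp add: mult.commute continuous_intros)

lemma continuous_on_expint:
  assumes h: "integrable (lebesgue_on {0..t}) h"
  shows "continuous_on S (expint t h)"
proof -
  have "(\<lambda>n. expint t h (Z n)) \<longlonglongrightarrow> expint t h z" if Z: "Z \<longlonglongrightarrow> z" for Z z
  proof -
    obtain K where K: "\<And>n. norm (Z n) \<le> K"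
      using convergent_imp_Bseq[OF convergentI[OF Z]] by (auto simp: Bseq_def)
    show "(\<lambda>n. expint t h (Z n)) \<longlonglongrightarrow> expint t h z"
      unfolding expint_def
    proof (rule integral_dominated_convergence)
      show "(\<lambda>s. exp (z * of_real s) * h s) \<in> borel_measurable (lebesgue_on {0..t})"
        "\<And>n. (\<lambda>s. exp (Z n * of_real s) * h s) \<in> borel_measurable (lebesgue_on {0..t})"
        using integrable_expint[OF h] by auto
      show "integrable (lebesgue_on {0..t}) (\<lambda>s. exp (K * \<bar>t\<bar>) * norm (h s))" using h by simp
      show "AE s in lebesgue_on {0..t}. (\<lambda>n. exp (Z n * of_real s) * h s) \<longlonglongrightarrow> exp (z * of_real s) * h s"
        by (intro AE_I2 tendsto_intros Z)
      show "AE s in lebesgue_on {0..t}. norm (exp (Z n * of_real s) * h s) \<le> exp (K * \<bar>t\<bar>) * norm (h s)" for n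
      proof (rule AE_I2)
        fix s assume "s \<in> space (lebesgue_on {0..t})"
        then have s: "0 \<le> s" "s \<le> t" by auto
        have "Re (Z n) * s \<le> norm (Z n) * s" using s by (intro mult_right_mono complex_Re_le_cmod)
        also have "\<dots> \<le> K * \<bar>t\<bar>" using s K[of n] order_trans[OF norm_ge_zero K[of n]] by (intro mult_mono) auto
        finally have "norm (exp (Z n * of_real s)) \<le> exp (K * \<bar>t\<bar>)" by simp
        then show "norm (exp (Z n * of_real s) * h s) \<le> exp (K * \<bar>t\<bar>) * norm (h s)"
          unfolding norm_mult by (intro mult_right_mono) auto
      qed
    qed
  qed
  then show ?thesis by (simp add: continuous_on_sequentially o_def)
qed

lemma lebesgue_on_integral_mono_set:
  fixes f :: "real \<Rightarrow> real"
  assumes f: "integrable (lebesgue_on {a..b}) f" "\<And>s. 0 \<le> f s" and "{c..d} \<subseteq> {a..b}"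
  shows "(LINT s|lebesgue_on {c..d}. f s) \<le> (LINT s|lebesgue_on {a..b}. f s)"
proof -
  have "indicator {c..d} s *\<^sub>R f s \<le> indicator {a..b} s *\<^sub>R f s" for s
    using assms by (auto simp: indicator_def)
  moreover have a: "set_integrable lebesgue {a..b} f"
    using f by (simp add: set_integrable_def integrable_restrict_space)
  moreover have "set_integrable lebesgue {c..d} f"
    using a by (rule set_integrable_subset) (use assms in auto)
  ultimately show ?thesis
    by (subst (1 2) integral_restrict_space) (auto simp: set_integrable_def intro!: integral_mono)
qed

lemma norm_expint_le:
  assumes h: "integrable (lebesgue_on {0..T}) h" and t: "t \<le> T" "0 \<le> T"
    and B: "Re z \<le> B" "0 \<le> B"
  shows "norm (expint t h z) \<le> exp (B * T) * (LINT s|lebesgue_on {0..T}. norm (h s))"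
proof -
  have "set_integrable lebesgue {0..T} h"
    using h by (simp add: set_integrable_def integrable_restrict_space)
  then have "set_integrable lebesgue {0..t} h"
    by (rule set_integrable_subset) (use t in auto)
  then have ht: "integrable (lebesgue_on {0..t}) h"
    by (simp add: set_integrable_def integrable_restrict_space)
  have "norm (expint t h z) \<le> (LINT s|lebesgue_on {0..t}. norm (exp (z * of_real s) * h s))"
    unfolding expint_def by (rule integral_norm_bound)
  also have "\<dots> \<le> (LINT s|lebesgue_on {0..t}. exp (B * T) * norm (h s))"
  proof (rule integral_mono)
    show "integrable (lebesgue_on {0..t}) (\<lambda>s. norm (exp (z * of_real s) * h s))"
      by (intro integrable_norm integrable_expint ht)
    show "integrable (lebesgue_on {0..t}) (\<lambda>s. exp (B * T) * norm (h s))" using ht by simp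
    fix s assume "s \<in> space (lebesgue_on {0..t})"
    then have s: "0 \<le> s" "s \<le> T" using t by auto
    have "Re z * s \<le> B * s" using s B by (intro mult_right_mono) auto
    also have "\<dots> \<le> B * T" using s B by (intro mult_left_mono) auto
    finally have "norm (exp (z * of_real s)) \<le> exp (B * T)" by simp
    then show "norm (exp (z * of_real s) * h s) \<le> exp (B * T) * norm (h s)"
      unfolding norm_mult by (intro mult_right_mono) auto
  qed
  also have "\<dots> = exp (B * T) * (LINT s|lebesgue_on {0..t}. norm (h s))" by simp
  also have "\<dots> \<le> exp (B * T) * (LINT s|lebesgue_on {0..T}. norm (h s))"
    by (intro mult_left_mono lebesgue_on_integral_mono_set) (use h t in auto)
  finally show ?thesis .
qed

section \<open>An $L^2$ bound for the transform on the imaginary axis\<close>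

lemma exponentials_orthogonal:
  assumes t: "t > 0" "\<delta> * t = 2 * pi"
  shows "(LINT s|lebesgue_on {0..t}. cnj (exp (\<i> * of_real (\<theta> + real m * \<delta>) * of_real s)) * exp (\<i> * of_real (\<theta> + real n * \<delta>) * of_real s))
     = (if m = n then of_real t else 0)"
proof -
  define d :: real where "d = (real n - real m) * \<delta>"
  have prod: "cnj (exp (\<i> * of_real (\<theta> + real m * \<delta>) * of_real s)) * exp (\<i> * of_real (\<theta> + real n * \<delta>) * of_real s)
      = exp (\<i> * of_real d * of_real s)" for s
    unfolding exp_cnj exp_add[symmetric] by (rule arg_cong[of _ _ exp]) (simp add: d_def algebra_simps)
  have "continuous_on {0..t} (\<lambda>s. exp (\<i> * of_real d * of_real s))" by (intro continuous_intros)
  then have eq: "(LINT s|lebesgue_on {0..t}. exp (\<i> * of_real d * of_real s)) = integral {0..t} (\<lambda>s. exp (\<i> * of_real d * of_real s))"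
    by (intro lebesgue_integral_eq_integral continuous_imp_integrable_real) auto
  have "(LINT s|lebesgue_on {0..t}. exp (\<i> * of_real d * of_real s)) = (if m = n then of_real t else 0)"
  proof (cases "m = n")
    case True
    then have "d = 0" by (simp add: d_def)
    then show ?thesis using True eq t by (simp add: scaleR_conv_of_real)
  next
    case False
    have "\<delta> \<noteq> 0" using t by auto
    then have d0: "d \<noteq> 0" using False by (simp add: d_def)
    have "((\<lambda>s. exp (\<i> * of_real d * of_real s)) has_integral
        exp (\<i> * of_real d * of_real t) / (\<i> * of_real d) - exp (\<i> * of_real d * of_real 0) / (\<i> * of_real d)) {0..t}"
      by (rule fundamental_theorem_of_calculus)
        (use t d0 in \<open>auto intro!: derivative_eq_intros has_vector_derivative_real_field\<close>)
    moreover have "exp (\<i> * of_real d * of_real t) = 1"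
    proof -
      have "\<i> * of_real d * of_real t = \<i> * (of_int (int n - int m) * (of_real (\<delta> * t)))"
        by (simp add: d_def)
      also have "\<dots> = \<i> * (of_int (int n - int m) * (of_real pi * 2))" using t by simp
      also have "exp \<dots> = 1" by (rule exp_2pi_1_int)
      finally show ?thesis .
    qed
    ultimately show ?thesis using False eq by (simp add: integral_unique)
  qed
  then show ?thesis unfolding prod .
qed

text \<open>With \<open>P\<close> the orthogonal projection of \<open>h\<close> onto the span of the (conjugated) exponentials, Bessel's
inequality comes from $2\,\mathrm{Re}(h \bar P) - |P|^2 \le |h|^2$: the integrals of $h \bar P$ and of
$|P|^2$ are both \<open>S / t\<close>, where \<open>S\<close> is the sum to be bounded.\<close>

lemma bessel_inequality_exponentials:
  assumes t: "t > 0" "\<delta> * t = 2 * pi" and h: "h square_integrable_on {0..t}"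
  shows "(\<Sum>n<N. (cmod (expint t h (\<i> * of_real (\<theta> + real n * \<delta>))))\<^sup>2) \<le> t * (LINT s|lebesgue_on {0..t}. (cmod (h s))\<^sup>2)"
proof -
  define e where "e n s = exp (\<i> * of_real (\<theta> + real n * \<delta>) * of_real s)" for n s
  define a where "a n = expint t h (\<i> * of_real (\<theta> + real n * \<delta>))" for n
  define P where "P s = (\<Sum>n<N. a n * cnj (e n s)) / of_real t" for s
  define S where "S = (\<Sum>n<N. (cmod (a n))\<^sup>2)"
  have ih: "integrable (lebesgue_on {0..t}) h" using h by (rule square_integrable_imp_integrable)
  have ce: "continuous_on A (e n)" for A n unfolding e_def by (intro continuous_intros)
  have cP: "continuous_on A P" for A unfolding P_def using t by (intro continuous_intros ce) auto
  have orth: "(LINT s|lebesgue_on {0..t}. cnj (e m s) * e n s) = (if m = n then of_real t else 0)" for m n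
    unfolding e_def by (rule exponentials_orthogonal[OF t])
  have ah: "(LINT s|lebesgue_on {0..t}. e n s * h s) = a n" for n by (simp add: a_def expint_def e_def)
  have Pe: "(LINT s|lebesgue_on {0..t}. e n s * P s) = a n" if "n < N" for n
  proof -
    have "(LINT s|lebesgue_on {0..t}. e n s * P s) = (LINT s|lebesgue_on {0..t}. (\<Sum>m<N. a m * (cnj (e m s) * e n s)) / of_real t)"
      by (intro Bochner_Integration.integral_cong refl) (simp add: P_def sum_distrib_left sum_divide_distrib algebra_simps)
    also have "\<dots> = (\<Sum>m<N. a m * (LINT s|lebesgue_on {0..t}. cnj (e m s) * e n s)) / of_real t"
      by (subst integral_divide_zero, subst Bochner_Integration.integral_sum)
         (auto intro!: continuous_imp_integrable_real continuous_intros ce)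
    also have "\<dots> = a n" using that t by (simp add: orth if_distrib[of "\<lambda>x. _ * x"] sum.delta cong: if_cong)
    finally show ?thesis .
  qed
  have key: "(LINT s|lebesgue_on {0..t}. cnj (P s) * f s) = of_real (S / t)"
    if f: "integrable (lebesgue_on {0..t}) f" "\<And>n. n < N \<Longrightarrow> (LINT s|lebesgue_on {0..t}. e n s * f s) = a n" for f
  proof -
    have i: "integrable (lebesgue_on {0..t}) (\<lambda>s. e n s * f s)" for n
      using integrable_mult_continuous[OF f(1) ce] by (simp add: mult.commute)
    have "(LINT s|lebesgue_on {0..t}. cnj (P s) * f s) = (LINT s|lebesgue_on {0..t}. (\<Sum>n<N. cnj (a n) * (e n s * f s)) / of_real t)"
      by (intro Bochner_Integration.integral_cong refl) (simp add: P_def sum_distrib_right mult.assoc)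
    also have "\<dots> = (\<Sum>n<N. cnj (a n) * (LINT s|lebesgue_on {0..t}. e n s * f s)) / of_real t"
      using i by (subst integral_divide_zero, subst Bochner_Integration.integral_sum) auto
    also have "\<dots> = (\<Sum>n<N. cnj (a n) * a n) / of_real t" using f(2) by simp
    also have "\<dots> = of_real (S / t)" by (simp add: S_def complex_norm_square mult.commute del: of_real_power)
    finally show ?thesis .
  qed
  have iP: "integrable (lebesgue_on {0..t}) P" by (rule continuous_imp_integrable_real[OF cP])
  have hP: "integrable (lebesgue_on {0..t}) (\<lambda>s. cnj (P s) * h s)"
    using integrable_mult_continuous[OF ih continuous_on_cnj[OF cP]] by (simp add: mult.commute)
  have PP: "integrable (lebesgue_on {0..t}) (\<lambda>s. cnj (P s) * P s)"
    by (intro continuous_imp_integrable_real continuous_intros cP)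
  have "2 * Re (LINT s|lebesgue_on {0..t}. cnj (P s) * h s) - Re (LINT s|lebesgue_on {0..t}. cnj (P s) * P s)
     = (LINT s|lebesgue_on {0..t}. 2 * Re (cnj (P s) * h s) - Re (cnj (P s) * P s))"
    by (subst Bochner_Integration.integral_diff[OF integrable_mult_right[OF integrable_Re[OF hP]] integrable_Re[OF PP]])
       (simp only: integral_mult_right_zero integral_Re[OF hP] integral_Re[OF PP])
  also have "\<dots> \<le> (LINT s|lebesgue_on {0..t}. (cmod (h s))\<^sup>2)"
  proof (rule integral_mono)
    show "integrable (lebesgue_on {0..t}) (\<lambda>s. 2 * Re (cnj (P s) * h s) - Re (cnj (P s) * P s))"
      using hP PP by (intro Bochner_Integration.integrable_diff integrable_mult_right integrable_Re)
    show "integrable (lebesgue_on {0..t}) (\<lambda>s. (cmod (h s))\<^sup>2)" using h by (simp add: square_integrable_on_def)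
    fix s
    have "0 \<le> (cmod (h s - P s))\<^sup>2" by simp
    then show "2 * Re (cnj (P s) * h s) - Re (cnj (P s) * P s) \<le> (cmod (h s))\<^sup>2"
      unfolding cmod_power2 by (simp add: power2_eq_square algebra_simps)
  qed
  finally have "S / t \<le> (LINT s|lebesgue_on {0..t}. (cmod (h s))\<^sup>2)"
    using key[OF ih ah] key[OF iP Pe] by simp
  then show ?thesis using t by (simp add: S_def a_def field_simps)
qed

text \<open>The intervals of length $\delta = 2\pi/t$ that cover \<open>[a, b]\<close> are translates of one of them, so the
integral is at most the integral over one period of the sum in Bessel's inequality, and
$\delta \cdot t = 2\pi$.\<close>

lemma expint_L2_bound:
  assumes t: "t > 0" and h: "h square_integrable_on {0..t}" and ab: "a \<le> b"
  shows "integral {a..b} (\<lambda>w. (cmod (expint t h (\<i> * of_real w)))\<^sup>2) \<le> 2 * pi * (LINT s|lebesgue_on {0..t}. (cmod (h s))\<^sup>2)"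
proof -
  define \<delta> where "\<delta> = 2 * pi / t"
  have \<delta>: "\<delta> > 0" "\<delta> * t = 2 * pi" using t by (auto simp: \<delta>_def)
  define f where "f w = (cmod (expint t h (\<i> * of_real w)))\<^sup>2" for w
  have "integrable (lebesgue_on {0..t}) h" using h by (rule square_integrable_imp_integrable)
  then have cf: "continuous_on A f" for A
    unfolding f_def by (intro continuous_intros continuous_on_compose2[OF continuous_on_expint[of t h UNIV]]) auto
  have cfn: "continuous_on A (\<lambda>w. f (w + real n * \<delta>))" for A n
    by (intro continuous_on_compose2[OF cf[of UNIV]] continuous_intros) auto
  have split: "integral {a..a + real N * \<delta>} f = (\<Sum>n<N. integral {a..a + \<delta>} (\<lambda>w. f (w + real n * \<delta>)))" for N
  proof (induction N)
    case (Suc N)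
    have "integral {a..a + real (Suc N) * \<delta>} f = integral {a..a + real N * \<delta>} f + integral {a + real N * \<delta>..a + real (Suc N) * \<delta>} f"
      using \<delta> by (intro Henstock_Kurzweil_Integration.integral_combine[symmetric] integrable_continuous_real cf) (auto simp: algebra_simps)
    also have "integral {a + real N * \<delta>..a + real (Suc N) * \<delta>} f = integral {a..a + \<delta>} (\<lambda>w. f (w + real N * \<delta>))"
      using integral_shift_real_ivl[of "a + real N * \<delta>" "real N * \<delta>" "a + real (Suc N) * \<delta>" f] by (simp add: algebra_simps)
    finally show ?case using Suc by simp
  qed simp
  obtain N :: nat where N: "real N > (b - a) / \<delta>" using reals_Archimedean2 by blast
  then have "b \<le> a + real N * \<delta>" using \<delta> by (simp add: field_simps)
  then have "integral {a..b} f \<le> integral {a..a + real N * \<delta>} f"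
    by (intro integral_subset_le integrable_continuous_real cf) (auto simp: f_def)
  also have "\<dots> = integral {a..a + \<delta>} (\<lambda>w. \<Sum>n<N. f (w + real n * \<delta>))"
    unfolding split by (intro integral_sum[symmetric] integrable_continuous_real cfn) auto
  also have "\<dots> \<le> integral {a..a + \<delta>} (\<lambda>w. t * (LINT s|lebesgue_on {0..t}. (cmod (h s))\<^sup>2))"
    using bessel_inequality_exponentials[OF t \<delta>(2) h]
    by (intro integral_le integrable_continuous_real continuous_intros cfn) (auto simp: f_def)
  also have "\<dots> = 2 * pi * (LINT s|lebesgue_on {0..t}. (cmod (h s))\<^sup>2)"
    using \<delta> by (simp add: mult.commute)
  finally show ?thesis unfolding f_def .
qed

lemma has_integral_inverse_square:
  assumes "0 < R" "R \<le> r"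
  shows "((\<lambda>\<rho>::real. 1 / \<rho>\<^sup>2) has_integral (1 / R - 1 / r)) {R..r}"
proof -
  have "((\<lambda>\<rho>::real. 1 / \<rho>\<^sup>2) has_integral (- (1 / r) - - (1 / R))) {R..r}"
    by (rule fundamental_theorem_of_calculus)
       (use assms in \<open>auto intro!: derivative_eq_intros simp: has_real_derivative_iff_has_vector_derivative[symmetric] power2_eq_square\<close>)
  then show ?thesis by simp
qed

text \<open>The constant does not depend on \<open>r\<close>, so the transform is absolutely integrable along a ray of
frequencies \<open>\<rho> ^ 3\<close>, although it need not be so in the variable $w = \rho^3$. The factor
$3\rho^2$ of the substitution is what absorbs the square, by
$y \le 3\rho^2y^2 + \rho^{-2}$.\<close>

lemma expint_ray_bound:
  assumes R: "0 < R" "R \<le> r" and t: "t > 0" and h: "h square_integrable_on {0..t}" and \<sigma>: "\<sigma> = 1 \<or> \<sigma> = -1"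
  shows "integral {R..r} (\<lambda>\<rho>. cmod (expint t h (\<i> * of_real (\<sigma> * \<rho> ^ 3)))) \<le> 2 * pi * (LINT s|lebesgue_on {0..t}. (cmod (h s))\<^sup>2) + 1 / R"
proof -
  define f where "f w = (cmod (expint t h (\<i> * of_real w)))\<^sup>2" for w
  have ih: "integrable (lebesgue_on {0..t}) h" using h by (rule square_integrable_imp_integrable)
  then have cf: "continuous_on A f" for A
    unfolding f_def by (intro continuous_intros continuous_on_compose2[OF continuous_on_expint[of t h UNIV]]) auto
  have cfs: "continuous_on A (\<lambda>w. f (\<sigma> * w))" for A
    by (intro continuous_on_compose2[OF cf[of UNIV]] continuous_intros) auto
  have R3: "R ^ 3 \<le> r ^ 3" using R by (intro power_mono) auto
  have b: "integral {R ^ 3..r ^ 3} (\<lambda>w. f (\<sigma> * w)) \<le> 2 * pi * (LINT s|lebesgue_on {0..t}. (cmod (h s))\<^sup>2)"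
    using \<sigma>
  proof
    assume "\<sigma> = 1"
    then show ?thesis using expint_L2_bound[OF t h R3] by (simp add: f_def)
  next
    assume "\<sigma> = -1"
    then show ?thesis using expint_L2_bound[OF t h, of "- (r ^ 3)" "- (R ^ 3)"] R3
        Henstock_Kurzweil_Integration.integral_reflect_real[of "r ^ 3" "R ^ 3" "\<lambda>w. f (- w)"]
      by (simp add: f_def)
  qed
  have sub: "((\<lambda>\<rho>. (3 * \<rho>\<^sup>2) *\<^sub>R f (\<sigma> * \<rho> ^ 3)) has_integral integral {R ^ 3..r ^ 3} (\<lambda>w. f (\<sigma> * w))) {R..r}"
    by (rule has_integral_substitution[where c = "R ^ 3" and d = "r ^ 3"])
       (use R R3 in \<open>auto intro!: cfs derivative_eq_intros power_mono\<close>)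
  note inv = has_integral_inverse_square[OF R]
  have "integral {R..r} (\<lambda>\<rho>. cmod (expint t h (\<i> * of_real (\<sigma> * \<rho> ^ 3)))) \<le>
     integral {R..r} (\<lambda>\<rho>. (3 * \<rho>\<^sup>2) *\<^sub>R f (\<sigma> * \<rho> ^ 3) + 1 / \<rho>\<^sup>2)"
  proof (rule integral_le)
    show "(\<lambda>\<rho>. cmod (expint t h (\<i> * of_real (\<sigma> * \<rho> ^ 3)))) integrable_on {R..r}"
      by (intro integrable_continuous_real continuous_intros continuous_on_compose2[OF continuous_on_expint[OF ih, of UNIV]]) auto
    show "(\<lambda>\<rho>. (3 * \<rho>\<^sup>2) *\<^sub>R f (\<sigma> * \<rho> ^ 3) + 1 / \<rho>\<^sup>2) integrable_on {R..r}"
      by (rule has_integral_integrable[OF has_integral_add[OF sub inv]])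
    fix \<rho> assume "\<rho> \<in> {R..r}"
    then have \<rho>: "\<rho> > 0" using R by auto
    define y where "y = cmod (expint t h (\<i> * of_real (\<sigma> * \<rho> ^ 3)))"
    have "0 \<le> (y * \<rho> - 1 / \<rho>)\<^sup>2" by simp
    also have "\<dots> = (y * \<rho>)\<^sup>2 - 2 * y + 1 / \<rho>\<^sup>2" using \<rho> by (simp add: power2_eq_square field_simps)
    also have "\<dots> \<le> 3 * (y * \<rho>)\<^sup>2 - y + 1 / \<rho>\<^sup>2" using zero_le_power2[of "y * \<rho>"] by (simp add: y_def)
    finally have "y \<le> 3 * (y * \<rho>)\<^sup>2 + 1 / \<rho>\<^sup>2" by simp
    then show "y \<le> (3 * \<rho>\<^sup>2) *\<^sub>R f (\<sigma> * \<rho> ^ 3) + 1 / \<rho>\<^sup>2"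
      by (simp only: f_def y_def[symmetric]) (simp add: power_mult_distrib mult.commute mult.left_commute)
  qed
  also have "\<dots> = integral {R ^ 3..r ^ 3} (\<lambda>w. f (\<sigma> * w)) + (1 / R - 1 / r)"
    by (rule integral_unique[OF has_integral_add[OF sub inv]])
  also have "\<dots> \<le> 2 * pi * (LINT s|lebesgue_on {0..t}. (cmod (h s))\<^sup>2) + 1 / R"
    using b zero_le_divide_iff[of 1 r] R by linarith
  finally show ?thesis .
qed

section \<open>Integrals over the boundary of the sector\<close>

lemma convergent_integral_at_top:
  fixes f :: "real \<Rightarrow> complex"
  assumes f: "continuous_on {R..} f" and M: "\<And>r. R < r \<Longrightarrow> integral {R..r} (\<lambda>\<rho>. norm (f \<rho>)) \<le> M"
  shows "\<exists>I. ((\<lambda>r. integral {R..r} f) \<longlongrightarrow> I) at_top"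
proof -
  define P where "P r = integral {R..r} (\<lambda>\<rho>. norm (f \<rho>))" for r
  have cf: "continuous_on {a..b} f" if "R \<le> a" for a b using f that by (auto intro: continuous_on_subset)
  have bdd: "bdd_above (P ` {R<..})" using M by (auto simp: P_def intro!: bdd_aboveI2)
  define L where "L = (SUP r\<in>{R<..}. P r)"
  have PL: "P r \<le> L" if "R < r" for r unfolding L_def using that bdd by (intro cSUP_upper) auto
  have diff: "norm (integral {R..y} f - integral {R..x} f) \<le> P y - P x" if "R < x" "x \<le> y" for x y
  proof -
    have "integral {R..y} f = integral {R..x} f + integral {x..y} f"
      using that by (intro Henstock_Kurzweil_Integration.integral_combine[symmetric] integrable_continuous_real cf) auto
    moreover have "P y = P x + integral {x..y} (\<lambda>\<rho>. norm (f \<rho>))"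
      unfolding P_def using that
      by (intro Henstock_Kurzweil_Integration.integral_combine[symmetric] integrable_continuous_real continuous_on_norm cf) auto
    moreover have "norm (integral {x..y} f) \<le> integral {x..y} (\<lambda>\<rho>. norm (f \<rho>))"
      using that by (intro integral_norm_bound_integral integrable_continuous_real continuous_on_norm cf) auto
    ultimately show ?thesis by simp
  qed
  have "cauchy_filter (filtermap (\<lambda>r. integral {R..r} f) at_top)"
    unfolding cauchy_filter_metric_filtermap
  proof (intro allI impI)
    fix e :: real assume "e > 0"
    then have "L - e < L" by simp
    then obtain r0 where r0: "R < r0" "L - e < P r0"
      using less_cSUP_iff[of "{R<..}" P "L - e"] bdd by (auto simp: L_def)
    have "dist (integral {R..x} f) (integral {R..y} f) < e" if "r0 \<le> x \<and> r0 \<le> y" for x y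
    proof -
      have 1: "P y' - P x' < e" if "r0 \<le> x'" "x' \<le> y'" for x' y'
        using diff[of r0 x'] PL[of y'] r0 that norm_ge_zero[of "integral {R..x'} f - integral {R..r0} f"] by linarith
      show ?thesis
      proof (cases "x \<le> y")
        case True
        then show ?thesis using diff[of x y] 1[of x y] that r0 by (simp add: dist_norm norm_minus_commute)
      next
        case False
        then show ?thesis using diff[of y x] 1[of y x] that r0 by (simp add: dist_norm)
      qed
    qed
    then show "\<exists>P. eventually P at_top \<and> (\<forall>x y. P x \<and> P y \<longrightarrow> dist (integral {R..x} f) (integral {R..y} f) < e)"
      using eventually_ge_at_top[of r0] by blast
  qed
  then show ?thesis
    using cauchy_filter_complete_converges[of "filtermap (\<lambda>r. integral {R..r} f) at_top" UNIV]
    by (auto simp: complete_UNIV filterlim_def filtermap_bot_iff)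
qed

lemma contour_integral_ray:
  assumes "R < r" and f: "continuous_on {R..r} (\<lambda>\<rho>. f (of_real \<rho> * c))"
  shows "(f has_contour_integral (c * integral {R..r} (\<lambda>\<rho>. f (of_real \<rho> * c)))) (linepath (of_real R * c) (of_real r * c))"
proof -
  define g where "g \<rho> = f (of_real \<rho> * c)" for \<rho> :: real
  have "(g has_integral (integral {R..r} g)) {R..r}"
    using f unfolding g_def by (intro integrable_integral integrable_continuous_real)
  then have "((\<lambda>x. g ((r - R) *\<^sub>R x + R)) has_integral (integral {R..r} g /\<^sub>R (r - R))) {0..1}"
    using has_integral_affinity'[of g "integral {R..r} g" R r "r - R" R] assms(1) by simp
  then have A: "((\<lambda>x. g ((r - R) *\<^sub>R x + R) * (of_real (r - R) * c)) has_integral ((integral {R..r} g /\<^sub>R (r - R)) * (of_real (r - R) * c))) {0..1}"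
    by (rule has_integral_mult_left)
  have B: "g ((r - R) *\<^sub>R x + R) * (of_real (r - R) * c)
     = f (linepath (of_real R * c) (of_real r * c) x) * (of_real r * c - of_real R * c)" for x
    by (simp add: g_def linepath_def algebra_simps scaleR_conv_of_real)
  have C: "(integral {R..r} g /\<^sub>R (r - R)) * (of_real (r - R) * c) = c * integral {R..r} g"
    using assms(1) by (simp add: scaleR_conv_of_real)
  have gg: "g = (\<lambda>\<rho>. f (of_real \<rho> * c))" by (simp add: g_def fun_eq_iff)
  show ?thesis
    unfolding has_contour_integral_linepath using A unfolding B C by (simp only: gg)
qed

lemma ray_direction_coordinates:
  "cos (pi / 3) = 1 / 2" "sin (pi / 3) = sqrt 3 / 2"
  "cos (2 * pi / 3) = - 1 / 2" "sin (2 * pi / 3) = sqrt 3 / 2"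
proof -
  have "2 * pi / 3 = pi - pi / 3" by simp
  then show "cos (2 * pi / 3) = - 1 / 2" "sin (2 * pi / 3) = sqrt 3 / 2"
    by (simp_all only: cos_pi_minus sin_pi_minus cos_60 sin_60 minus_divide_left)
qed (simp_all add: cos_60 sin_60)

lemma ray_direction_cubes: "cis (pi / 3) ^ 3 = - 1" "cis (2 * pi / 3) ^ 3 = 1"
  by (simp_all add: Complex.DeMoivre complex_eq_iff)

lemma arc_norm_Im:
  assumes "0 < R" "k \<in> path_image (part_circlepath 0 R (2 * pi / 3) (pi / 3))"
  shows "norm k = R" "0 < Im k"
proof -
  obtain \<theta> where \<theta>: "\<theta> \<in> closed_segment (2 * pi / 3) (pi / 3)" "k = of_real R * cis \<theta>"
    using assms(2) by (auto simp: path_image_part_circlepath')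
  then show "norm k = R" using assms(1) by (simp add: norm_mult)
  have "pi / 3 \<le> \<theta>" "\<theta> \<le> 2 * pi / 3" using \<theta>(1) pi_gt_zero by (auto simp: closed_segment_eq_real_ivl)
  then have "0 < \<theta>" "\<theta> < pi" using pi_gt_zero by linarith+
  then show "0 < Im k" using assms(1) \<theta>(2) by (simp add: sin_gt_zero)
qed

text \<open>The sign of the second term reflects that the ray with argument $2\pi/3$ is traversed inwards.\<close>

lemma bdry_D1_integral:
  assumes R: "0 < R" "R < r" and f: "continuous_on (- {0}) f"
  shows "f contour_integrable_on bdry_D1 R r"
    and "contour_integral (bdry_D1 R r) f =
      cis (pi / 3) * integral {R..r} (\<lambda>\<rho>. f (of_real \<rho> * cis (pi / 3)))
      - cis (2 * pi / 3) * integral {R..r} (\<lambda>\<rho>. f (of_real \<rho> * cis (2 * pi / 3)))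
      + contour_integral (part_circlepath 0 R (2 * pi / 3) (pi / 3)) f"
proof -
  have c: "continuous_on {R..r} (\<lambda>\<rho>. f (of_real \<rho> * cis \<theta>))" for \<theta>
    by (rule continuous_on_compose2[OF f]) (use R in \<open>auto intro!: continuous_intros\<close>)
  have "continuous_on (path_image (part_circlepath 0 R (2 * pi / 3) (pi / 3))) f"
    by (rule continuous_on_subset[OF f]) (use arc_norm_Im[OF R(1)] R in fastforce)
  then have arc: "(f has_contour_integral (contour_integral (part_circlepath 0 R (2 * pi / 3) (pi / 3)) f))
      (part_circlepath 0 R (2 * pi / 3) (pi / 3))"
    by (intro has_contour_integral_integral contour_integrable_continuous_part_circlepath)
  have "(f has_contour_integral
     (- (cis (2 * pi / 3) * integral {R..r} (\<lambda>\<rho>. f (of_real \<rho> * cis (2 * pi / 3))))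
      + (contour_integral (part_circlepath 0 R (2 * pi / 3) (pi / 3)) f
      + cis (pi / 3) * integral {R..r} (\<lambda>\<rho>. f (of_real \<rho> * cis (pi / 3)))))) (bdry_D1 R r)"
    unfolding bdry_D1_def
    by (intro has_contour_integral_join has_contour_integral_reverse_linepath[OF contour_integral_ray] contour_integral_ray arc c R)
       (auto simp: cis_conv_exp intro!: valid_path_join)
  then show "f contour_integrable_on bdry_D1 R r"
    and "contour_integral (bdry_D1 R r) f =
      cis (pi / 3) * integral {R..r} (\<lambda>\<rho>. f (of_real \<rho> * cis (pi / 3)))
      - cis (2 * pi / 3) * integral {R..r} (\<lambda>\<rho>. f (of_real \<rho> * cis (2 * pi / 3)))
      + contour_integral (part_circlepath 0 R (2 * pi / 3) (pi / 3)) f"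
    by (auto simp: contour_integrable_on_def dest: contour_integral_unique)
qed

lemma bdry_D1_in_upper_half_plane:
  assumes R: "0 < R" "R < r"
  shows "path_image (bdry_D1 R r) \<subseteq> {k. 0 < Im k}"
proof -
  have "of_real \<rho> * cis (2 * pi / 3) \<in> {k. 0 < Im k}" "of_real \<rho> * cis (pi / 3) \<in> {k. 0 < Im k}" if "\<rho> > 0" for \<rho>
    using that by (simp_all add: ray_direction_coordinates)
  moreover have "0 < r" using R by simp
  ultimately have "closed_segment (of_real r * cis (2 * pi / 3)) (of_real R * cis (2 * pi / 3)) \<subseteq> {k. 0 < Im k}"
      "closed_segment (of_real R * cis (pi / 3)) (of_real r * cis (pi / 3)) \<subseteq> {k. 0 < Im k}"
    using R(1) by (intro closed_segment_subset convex_halfspace_Im_gt; blast)+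
  then show ?thesis
    unfolding bdry_D1_def using arc_norm_Im[OF R(1)] by (intro subset_path_image_join) auto
qed

lemma tendsto_D1_integral:
  assumes "D1_integral_converges R f"
  shows "((\<lambda>r. contour_integral (bdry_D1 R r) f) \<longlongrightarrow> D1_integral R f) at_top"
  using assms unfolding D1_integral_converges_def D1_integral_def
  by (metis tendsto_Lim trivial_limit_at_top_linorder)

lemma D1_integral_convergesI:
  assumes R: "0 < R" and f: "continuous_on (- {0}) f"
    and M: "\<And>c r. c \<in> {cis (pi / 3), cis (2 * pi / 3)} \<Longrightarrow> R < r \<Longrightarrow> integral {R..r} (\<lambda>\<rho>. norm (f (of_real \<rho> * c))) \<le> M"
  shows "D1_integral_converges R f"
  unfolding D1_integral_converges_def
proof
  show "\<forall>r>R. f contour_integrable_on bdry_D1 R r" using bdry_D1_integral(1)[OF R _ f] by blast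
  have c: "continuous_on {R..} (\<lambda>\<rho>. f (of_real \<rho> * cis \<theta>))" for \<theta>
    by (rule continuous_on_compose2[OF f]) (use R in \<open>auto intro!: continuous_intros\<close>)
  obtain I1 where I1: "((\<lambda>r. integral {R..r} (\<lambda>\<rho>. f (of_real \<rho> * cis (pi / 3)))) \<longlongrightarrow> I1) at_top"
    using convergent_integral_at_top[OF c M, of "pi / 3"] by auto
  obtain I2 where I2: "((\<lambda>r. integral {R..r} (\<lambda>\<rho>. f (of_real \<rho> * cis (2 * pi / 3)))) \<longlongrightarrow> I2) at_top"
    using convergent_integral_at_top[OF c M, of "2 * pi / 3"] by auto
  have "((\<lambda>r. contour_integral (bdry_D1 R r) f) \<longlongrightarrow>
      cis (pi / 3) * I1 - cis (2 * pi / 3) * I2 + contour_integral (part_circlepath 0 R (2 * pi / 3) (pi / 3)) f) at_top"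
  proof (rule Lim_transform_eventually)
    show "((\<lambda>r. cis (pi / 3) * integral {R..r} (\<lambda>\<rho>. f (of_real \<rho> * cis (pi / 3)))
      - cis (2 * pi / 3) * integral {R..r} (\<lambda>\<rho>. f (of_real \<rho> * cis (2 * pi / 3)))
      + contour_integral (part_circlepath 0 R (2 * pi / 3) (pi / 3)) f) \<longlongrightarrow>
      cis (pi / 3) * I1 - cis (2 * pi / 3) * I2 + contour_integral (part_circlepath 0 R (2 * pi / 3) (pi / 3)) f) at_top"
      by (intro tendsto_intros I1 I2)
    show "\<forall>\<^sub>F r in at_top. cis (pi / 3) * integral {R..r} (\<lambda>\<rho>. f (of_real \<rho> * cis (pi / 3)))
      - cis (2 * pi / 3) * integral {R..r} (\<lambda>\<rho>. f (of_real \<rho> * cis (2 * pi / 3)))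
      + contour_integral (part_circlepath 0 R (2 * pi / 3) (pi / 3)) f = contour_integral (bdry_D1 R r) f"
      using eventually_gt_at_top[of R] by eventually_elim (use bdry_D1_integral(2)[OF R _ f] in simp)
  qed
  then show "\<exists>I. ((\<lambda>r. contour_integral (bdry_D1 R r) f) \<longlongrightarrow> I) at_top" by blast
qed

lemma norm_bdry_D1_integral_le:
  assumes R: "0 < R" "R < r" and f: "continuous_on (- {0}) f"
    and M: "\<And>c. c \<in> {cis (pi / 3), cis (2 * pi / 3)} \<Longrightarrow> integral {R..r} (\<lambda>\<rho>. norm (f (of_real \<rho> * c))) \<le> M"
    and B: "\<And>k. norm k = R \<Longrightarrow> norm (f k) \<le> B"
  shows "norm (contour_integral (bdry_D1 R r) f) \<le> 2 * M + B * R * (pi / 3)"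
proof -
  have ray: "norm (cis \<theta> * integral {R..r} (\<lambda>\<rho>. f (of_real \<rho> * cis \<theta>))) \<le> M"
    if "cis \<theta> \<in> {cis (pi / 3), cis (2 * pi / 3)}" for \<theta>
  proof -
    have c: "continuous_on {R..r} (\<lambda>\<rho>. f (of_real \<rho> * cis \<theta>))"
      by (rule continuous_on_compose2[OF f]) (use R in \<open>auto intro!: continuous_intros\<close>)
    have "norm (integral {R..r} (\<lambda>\<rho>. f (of_real \<rho> * cis \<theta>))) \<le> integral {R..r} (\<lambda>\<rho>. norm (f (of_real \<rho> * cis \<theta>)))"
      by (intro integral_norm_bound_integral integrable_continuous_real continuous_on_norm c) auto
    then show ?thesis using M[OF that] by (simp add: norm_mult)
  qed
  have B0: "0 \<le> B" using B[of "of_real R"] R order_trans[OF norm_ge_zero] by simp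
  have "continuous_on (path_image (part_circlepath 0 R (2 * pi / 3) (pi / 3))) f"
    by (rule continuous_on_subset[OF f]) (use arc_norm_Im[OF R(1)] R in fastforce)
  then have arc: "norm (contour_integral (part_circlepath 0 R (2 * pi / 3) (pi / 3)) f) \<le> B * R * \<bar>pi / 3 - 2 * pi / 3\<bar>"
    using arc_norm_Im[OF R(1)] B B0 R
    by (intro contour_integral_bound_part_circlepath contour_integrable_continuous_part_circlepath) auto
  have "\<bar>pi / 3 - 2 * pi / 3\<bar> = pi / 3" using pi_gt_zero by (simp add: field_simps)
  note arc = arc[unfolded this]
  have "norm (contour_integral (bdry_D1 R r) f) \<le> M + M + B * R * (pi / 3)"
    unfolding bdry_D1_integral(2)[OF R f]
    by (intro norm_triangle_le norm_triangle_le_diff add_mono ray arc) auto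
  then show ?thesis by simp
qed

text \<open>By Cauchy's theorem in the upper half plane only the horizontal segment from $re^{2\pi i/3}$ to
$re^{i\pi/3}$ matters. Its length is \<open>r\<close>, its height is $h = r\sqrt3/2$, and on it the integrand is
bounded by $e^{-hx}/h \le 1/(h^2x)$, so the integral is $O(1/r)$.\<close>

lemma bdry_D1_integral_exp_tendsto_0:
  assumes R: "0 < R" and x: "0 < x"
  shows "((\<lambda>r. contour_integral (bdry_D1 R r) (\<lambda>k. exp (\<i> * k * of_real x) / (\<i> * k))) \<longlongrightarrow> 0) at_top"
proof (rule Lim_null_comparison)
  define E where "E k = exp (\<i> * k * of_real x) / (\<i> * k)" for k
  define H where "H = {k. 0 < Im k}"
  have "open H" "convex H" unfolding H_def by (simp_all add: open_halfspace_Im_gt convex_halfspace_Im_gt)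
  moreover have "E holomorphic_on H" unfolding E_def H_def by (intro holomorphic_intros) auto
  ultimately obtain F where F: "\<And>k. k \<in> H \<Longrightarrow> (F has_field_derivative E k) (at k within H)"
    by (metis holomorphic_convex_primitive')
  show "\<forall>\<^sub>F r in at_top. norm (contour_integral (bdry_D1 R r) (\<lambda>k. exp (\<i> * k * of_real x) / (\<i> * k))) \<le> 4 / (3 * x) * inverse r"
    using eventually_gt_at_top[of R]
  proof eventually_elim
    case (elim r)
    have r: "0 < r" using elim R by simp
    define a b where "a = of_real r * cis (2 * pi / 3)" and "b = of_real r * cis (pi / 3)"
    have Ha: "of_real \<rho> * cis (2 * pi / 3) \<in> H" "of_real \<rho> * cis (pi / 3) \<in> H" if "\<rho> > 0" for \<rho>
      using that by (simp_all add: H_def ray_direction_coordinates)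
    have ends: "pathstart (bdry_D1 R r) = a" "pathfinish (bdry_D1 R r) = b"
      by (simp_all add: bdry_D1_def a_def b_def)
    have "path_image (bdry_D1 R r) \<subseteq> H"
      unfolding H_def by (rule bdry_D1_in_upper_half_plane[OF R elim])
    moreover have "valid_path (bdry_D1 R r)" unfolding bdry_D1_def
      by (auto simp: cis_conv_exp intro!: valid_path_join)
    ultimately have 1: "(E has_contour_integral (F b - F a)) (bdry_D1 R r)"
      using contour_integral_primitive[OF F] ends by metis
    have seg: "closed_segment a b \<subseteq> H"
      using Ha[OF r] \<open>convex H\<close> by (simp add: a_def b_def closed_segment_subset)
    have 2: "(E has_contour_integral (F b - F a)) (linepath a b)"
      using contour_integral_primitive[OF F, of "linepath a b"] seg by simp
    have "norm (F b - F a) \<le> (2 / (sqrt 3 * r)) * (2 / (sqrt 3 * r * x)) * norm (b - a)"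
    proof (rule has_contour_integral_bound_linepath[OF 2])
      show "0 \<le> (2 / (sqrt 3 * r)) * (2 / (sqrt 3 * r * x))" using r x by simp
      fix k assume "k \<in> closed_segment a b"
      then obtain u where "k = (1 - u) *\<^sub>R a + u *\<^sub>R b" by (auto simp: closed_segment_def)
      then have "Im k = (1 - u) * (r * sin (2 * pi / 3)) + u * (r * sin (pi / 3))"
        by (simp add: a_def b_def)
      then have im: "Im k = r * (sqrt 3 / 2)"
        unfolding ray_direction_coordinates by (simp add: field_simps)
      have "r * (sqrt 3 / 2) \<le> norm k" using abs_Im_le_cmod[of k] im by simp
      then have "1 / norm k \<le> 1 / (r * (sqrt 3 / 2))" using r by (intro frac_le) auto
      also have "\<dots> = 2 / (sqrt 3 * r)" by simp
      finally have n: "1 / norm k \<le> 2 / (sqrt 3 * r)" .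
      define y where "y = sqrt 3 * r * x / 2"
      have y: "y > 0" using r x by (simp add: y_def)
      have "Re (\<i> * k * of_real x) = - (Im k * x)" by simp
      then have re: "Re (\<i> * k * of_real x) = - y" unfolding im by (simp add: y_def mult.commute)
      have "y \<le> exp y" using exp_ge_add_one_self[of y] by linarith
      then have "exp (- y) \<le> 1 / y" using y by (simp add: exp_minus field_simps)
      then have "norm (exp (\<i> * k * of_real x)) \<le> 2 / (sqrt 3 * r * x)"
        unfolding norm_exp_eq_Re re by (simp add: y_def)
      then have "(1 / norm k) * norm (exp (\<i> * k * of_real x)) \<le> (2 / (sqrt 3 * r)) * (2 / (sqrt 3 * r * x))"
        using n r x by (intro mult_mono) auto
      then show "norm (E k) \<le> (2 / (sqrt 3 * r)) * (2 / (sqrt 3 * r * x))"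
        by (simp add: E_def norm_divide norm_mult)
    qed
    also have "b - a = of_real r"
      by (simp add: a_def b_def complex_eq_iff ray_direction_coordinates)
    also have "(2 / (sqrt 3 * r)) * (2 / (sqrt 3 * r * x)) * norm (of_real r :: complex) = 4 / (3 * x) * inverse r"
      using r x by (simp add: field_simps)
    finally show ?case using contour_integral_unique[OF 1] by (simp add: E_def[abs_def])
  qed
  show "((\<lambda>r. 4 / (3 * x) * inverse r) \<longlongrightarrow> 0) at_top"
    by (intro tendsto_mult_right_zero tendsto_inverse_0_at_top filterlim_ident)
qed

section \<open>Exponentials on the rays and convergence of the integrals\<close>

lemma norm_exp_diff_le:
  fixes a b :: complex
  assumes "Re a \<le> B" "Re b \<le> B"
  shows "norm (exp a - exp b) \<le> exp B * norm (a - b)"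
proof (rule field_differentiable_bound[where S = "{z. Re z \<le> B}" and f' = exp])
  show "convex {z. Re z \<le> B}" by (rule convex_halfspace_Re_le)
qed (use assms in \<open>auto intro!: derivative_eq_intros\<close>)

lemma min_two_cube_le:
  fixes y z :: real
  assumes "0 \<le> y" "z \<le> 2" "z \<le> y ^ 3"
  shows "z \<le> 2 * y"
proof (cases "y \<le> 1")
  case True
  then have "y ^ 3 \<le> y ^ 1" using assms(1) by (intro power_decreasing) auto
  then show ?thesis using assms by simp
qed (use assms in auto)

lemma ray_powers:
  assumes "c \<in> {cis (pi / 3), cis (2 * pi / 3)}"
  obtains \<sigma> :: real where "\<sigma> = 1 \<or> \<sigma> = -1" "\<And>\<rho>. \<i> * \<omega> (of_real \<rho> * c) = \<i> * of_real (\<sigma> * \<rho> ^ 3)"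
  using assms ray_direction_cubes
  by (cases "c = cis (pi / 3)") (auto simp: \<omega>_def power_mult_distrib intro: that[of 1] that[of "-1"])

lemma ray_exponents:
  assumes "c \<in> {cis (pi / 3), cis (2 * pi / 3)}"
  shows "norm c = 1" "Re (\<i> * (of_real \<rho> * c) * of_real x) = - (\<rho> * x * (sqrt 3 / 2))"
    "Re (\<i> * \<omega> (of_real \<rho> * c)) = 0"
proof -
  show "norm c = 1" "Re (\<i> * (of_real \<rho> * c) * of_real x) = - (\<rho> * x * (sqrt 3 / 2))"
    using assms by (auto simp: ray_direction_coordinates)
  obtain \<sigma> :: real where "\<i> * \<omega> (of_real \<rho> * c) = \<i> * of_real (\<sigma> * \<rho> ^ 3)"
    using ray_powers[OF assms] by metis
  then show "Re (\<i> * \<omega> (of_real \<rho> * c)) = 0" by (simp del: of_real_mult of_real_power)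
qed

lemma norm_exponential_ray_le:
  assumes c: "c \<in> {cis (pi / 3), cis (2 * pi / 3)}" and "0 \<le> \<rho>" "0 \<le> x"
  shows "norm (exp (\<i> * (of_real \<rho> * c) * of_real x - \<i> * \<omega> (of_real \<rho> * c) * of_real t)) = exp (- (\<rho> * x * (sqrt 3 / 2)))"
proof -
  have "Re (\<i> * (of_real \<rho> * c) * of_real x - \<i> * \<omega> (of_real \<rho> * c) * of_real t)
    = Re (\<i> * (of_real \<rho> * c) * of_real x) - Re (\<i> * \<omega> (of_real \<rho> * c)) * t"
    by (simp add: algebra_simps)
  then show ?thesis unfolding norm_exp_eq_Re ray_exponents[OF c] by simp
qed

text \<open>The spatial factor is Lipschitz because $ik$ points into the left half plane along the rays. In
time, the difference of two numbers on the unit circle is at most $2$ and at most $\rho^3|t-\tau|$, hence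
at most $2\rho|t-\tau|^{1/3}$; the exponent $1/3$ is chosen so that the dependence on \<open>\<rho>\<close> is linear, as for
the spatial factor, and cancels against the denominator \<open>\<i> * k\<close>.\<close>

lemma norm_exponential_diff_ray_le:
  assumes c: "c \<in> {cis (pi / 3), cis (2 * pi / 3)}" and \<rho>: "0 \<le> \<rho>" and xs: "0 \<le> x" "0 \<le> s"
  shows "norm (exp (\<i> * (of_real \<rho> * c) * of_real x - \<i> * \<omega> (of_real \<rho> * c) * of_real t)
      - exp (\<i> * (of_real \<rho> * c) * of_real s - \<i> * \<omega> (of_real \<rho> * c) * of_real \<tau>))
    \<le> \<rho> * (\<bar>x - s\<bar> + 2 * \<bar>t - \<tau>\<bar> powr (1/3))"
proof -
  define k where "k = of_real \<rho> * c"
  define a b where "a y = \<i> * k * of_real y" and "b u = - (\<i> * \<omega> k * of_real u)" for y u :: real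
  have a: "Re (a y) \<le> 0" if "0 \<le> y" for y
    unfolding a_def k_def ray_exponents(2)[OF c] using \<rho> that by simp
  have b: "Re (b u) = 0" for u
    using ray_exponents(3)[OF c, of \<rho>] by (simp add: b_def k_def)
  have nk: "norm k = \<rho>" using ray_exponents(1)[OF c] \<rho> by (simp add: k_def norm_mult)
  have A: "norm (exp (a x) - exp (a s)) \<le> \<rho> * \<bar>x - s\<bar>"
  proof -
    have "norm (exp (a x) - exp (a s)) \<le> exp 0 * norm (a x - a s)"
      by (rule norm_exp_diff_le) (use a xs in auto)
    also have "a x - a s = \<i> * k * of_real (x - s)" by (simp add: a_def algebra_simps)
    finally show ?thesis by (simp only: norm_mult nk norm_of_real norm_ii exp_zero mult_1)
  qed
  have B: "norm (exp (b t) - exp (b \<tau>)) \<le> 2 * (\<rho> * \<bar>t - \<tau>\<bar> powr (1/3))"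
  proof (rule min_two_cube_le)
    show "norm (exp (b t) - exp (b \<tau>)) \<le> 2"
      using norm_triangle_ineq4[of "exp (b t)" "exp (b \<tau>)"] b by simp
    have "norm (exp (b t) - exp (b \<tau>)) \<le> exp 0 * norm (b t - b \<tau>)"
      by (rule norm_exp_diff_le) (use b in auto)
    also have "b t - b \<tau> = - \<i> * \<omega> k * of_real (t - \<tau>)" by (simp add: b_def algebra_simps)
    also have "exp 0 * norm \<dots> = \<rho> ^ 3 * \<bar>t - \<tau>\<bar>"
      using nk by (simp add: norm_mult \<omega>_def norm_power flip: of_real_diff)
    also have "\<bar>t - \<tau>\<bar> = (\<bar>t - \<tau>\<bar> powr (1/3)) ^ 3"
      by (cases "t = \<tau>") (simp_all add: powr_power)
    finally show "norm (exp (b t) - exp (b \<tau>)) \<le> (\<rho> * \<bar>t - \<tau>\<bar> powr (1/3)) ^ 3"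
      by (simp only: power_mult_distrib)
  qed (use \<rho> in simp)
  have "exp (a x + b t) - exp (a s + b \<tau>) = exp (b t) * (exp (a x) - exp (a s)) + exp (a s) * (exp (b t) - exp (b \<tau>))"
    by (simp add: exp_add algebra_simps)
  also have "norm \<dots> \<le> norm (exp (b t)) * norm (exp (a x) - exp (a s)) + norm (exp (a s)) * norm (exp (b t) - exp (b \<tau>))"
    by (rule order_trans[OF norm_triangle_ineq]) (simp only: norm_mult order_refl)
  also have "\<dots> \<le> 1 * (\<rho> * \<bar>x - s\<bar>) + 1 * (2 * (\<rho> * \<bar>t - \<tau>\<bar> powr (1/3)))"
    by (intro add_mono mult_mono A B) (use a[OF xs(2)] b in auto)
  finally show ?thesis by (simp add: a_def b_def k_def algebra_simps)
qed

lemma G_0_0_eq_expint: "G_0_0 h t k = expint t h (\<i> * \<omega> k)"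
  by (simp add: G_0_0_def expint_def)

lemma G_integrand_eq:
  "G_integrand h t s \<tau> k = exp (\<i> * k * of_real s - \<i> * \<omega> k * of_real \<tau>) * expint t h (\<i> * \<omega> k) / (\<i> * k)"
  by (simp add: G_integrand_def G_0_0_eq_expint)

lemma continuous_on_integrands:
  assumes "integrable (lebesgue_on {0..t}) h"
  shows "continuous_on (- {0}) (G_integrand h t s \<tau>)"
    and "continuous_on (- {0}) (I_integrand x u)"
    and "continuous_on (- {0}) (q_integrand h x t)"
proof -
  have c: "continuous_on (- {0}) (\<lambda>k. expint t h (\<i> * \<omega> k))"
    by (rule continuous_on_compose2[OF continuous_on_expint[OF assms, of UNIV]])
       (auto simp: \<omega>_def intro!: continuous_intros)
  show "continuous_on (- {0}) (G_integrand h t s \<tau>)"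
    unfolding G_integrand_eq[abs_def] by (intro continuous_intros c) (auto simp: \<omega>_def intro!: continuous_intros)
  show "continuous_on (- {0}) (I_integrand x u)"
    unfolding I_integrand_def[abs_def] by (intro continuous_intros) (auto simp: \<omega>_def intro!: continuous_intros)
  have "q_integrand h x t = (\<lambda>k. 3 * k\<^sup>2 * exp (\<i> * k * of_real x - \<i> * \<omega> k * of_real t) * expint t h (\<i> * \<omega> k))"
    by (simp add: q_integrand_def g_tilde_def expint_def fun_eq_iff)
  then show "continuous_on (- {0}) (q_integrand h x t)"
    by (simp only:) (intro continuous_intros c, auto simp: \<omega>_def intro!: continuous_intros)
qed

text \<open>Positivity of \<open>x\<close> gives exponential decay along the rays, used only in the form
$e^{-a\rho} \le 1/(a\rho)$.\<close>

lemma I_integrand_converges: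
  assumes R: "0 < R" and x: "0 < x"
  shows "D1_integral_converges R (I_integrand x t)"
proof (rule D1_integral_convergesI[OF R continuous_on_integrands(2)])
  show "integrable (lebesgue_on {0..0}) (\<lambda>_. 0)" by simp
  fix c :: complex and r assume c: "c \<in> {cis (pi / 3), cis (2 * pi / 3)}" and r: "R < r"
  define a where "a = x * (sqrt 3 / 2)"
  have a: "a > 0" using x by (simp add: a_def)
  note inv = has_integral_mult_right[OF has_integral_inverse_square[OF R less_imp_le[OF r]], of "1 / a"]
  have "integral {R..r} (\<lambda>\<rho>. norm (I_integrand x t (of_real \<rho> * c))) \<le> integral {R..r} (\<lambda>\<rho>. (1 / a) * (1 / \<rho>\<^sup>2))"
  proof (rule integral_le)
    show "(\<lambda>\<rho>. norm (I_integrand x t (of_real \<rho> * c))) integrable_on {R..r}"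
      by (intro integrable_continuous_real continuous_on_norm
            continuous_on_compose2[OF continuous_on_integrands(2)[of 0 "\<lambda>_. 0"]])
         (use R c in \<open>auto intro!: continuous_intros\<close>)
    show "(\<lambda>\<rho>. (1 / a) * (1 / \<rho>\<^sup>2)) integrable_on {R..r}" using inv by (rule has_integral_integrable)
    fix \<rho> assume "\<rho> \<in> {R..r}"
    then have \<rho>: "\<rho> > 0" using R by auto
    have "a * \<rho> \<le> exp (a * \<rho>)" using exp_ge_add_one_self[of "a * \<rho>"] by linarith
    then have e: "exp (- (\<rho> * x * (sqrt 3 / 2))) \<le> 1 / (a * \<rho>)" using a \<rho>
      by (simp add: exp_minus field_simps a_def)
    have "norm (I_integrand x t (of_real \<rho> * c)) = exp (- (\<rho> * x * (sqrt 3 / 2))) * (1 / \<rho>)"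
      unfolding I_integrand_def norm_mult norm_divide
        norm_exponential_ray_le[OF c less_imp_le[OF \<rho>] less_imp_le[OF x]]
      using ray_exponents(1)[OF c] \<rho> by (simp add: norm_mult)
    also have "\<dots> \<le> 1 / (a * \<rho>) * (1 / \<rho>)" using \<rho> e by (intro mult_right_mono) auto
    finally show "norm (I_integrand x t (of_real \<rho> * c)) \<le> (1 / a) * (1 / \<rho>\<^sup>2)"
      by (simp add: power2_eq_square)
  qed
  also have "\<dots> = 1 / a * (1 / R - 1 / r)" using inv by (rule integral_unique)
  also have "\<dots> \<le> 1 / a * (1 / R)" using a R r by (intro mult_left_mono) auto
  finally show "integral {R..r} (\<lambda>\<rho>. norm (I_integrand x t (of_real \<rho> * c))) \<le> 1 / a * (1 / R)" .
qed

lemma expint_omega_ray_bound: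
  assumes R: "0 < R" "R \<le> r" and t: "t > 0" "t \<le> T" and h: "h square_integrable_on {0..T}"
    and c: "c \<in> {cis (pi / 3), cis (2 * pi / 3)}"
  shows "integral {R..r} (\<lambda>\<rho>. norm (expint t h (\<i> * \<omega> (of_real \<rho> * c)))) \<le> 2 * pi * (LINT s|lebesgue_on {0..T}. (cmod (h s))\<^sup>2) + 1 / R"
proof -
  have ht: "h square_integrable_on {0..t}" using square_integrable_on_subset[OF h] t by auto
  obtain \<sigma> :: real where \<sigma>: "\<sigma> = 1 \<or> \<sigma> = -1" "\<And>\<rho>. \<i> * \<omega> (of_real \<rho> * c) = \<i> * of_real (\<sigma> * \<rho> ^ 3)"
    using ray_powers[OF c] by metis
  have "(LINT s|lebesgue_on {0..t}. (cmod (h s))\<^sup>2) \<le> (LINT s|lebesgue_on {0..T}. (cmod (h s))\<^sup>2)"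
    by (rule lebesgue_on_integral_mono_set) (use h t in \<open>auto simp: square_integrable_on_def\<close>)
  then have "2 * pi * (LINT s|lebesgue_on {0..t}. (cmod (h s))\<^sup>2) \<le> 2 * pi * (LINT s|lebesgue_on {0..T}. (cmod (h s))\<^sup>2)"
    by (intro mult_left_mono) auto
  then show ?thesis
    unfolding \<sigma>(2) using expint_ray_bound[OF R t(1) ht \<sigma>(1)] by linarith
qed

text \<open>This includes \<open>s = 0\<close>, where the exponential does not decay along the rays and convergence comes
from the square integrability of the transform alone.\<close>

lemma G_integrand_converges:
  assumes R: "0 < R" and t: "0 < t" "t \<le> T" and h: "h square_integrable_on {0..T}" and s: "0 \<le> s"
  shows "D1_integral_converges R (G_integrand h t s \<tau>)"
proof -
  have ih: "integrable (lebesgue_on {0..t}) h"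
    using square_integrable_imp_integrable[OF square_integrable_on_subset[OF h]] t by auto
  show ?thesis
  proof (rule D1_integral_convergesI[OF R continuous_on_integrands(1)[OF ih]])
    fix c :: complex and r assume c: "c \<in> {cis (pi / 3), cis (2 * pi / 3)}" and r: "R < r"
    have "integral {R..r} (\<lambda>\<rho>. norm (G_integrand h t s \<tau> (of_real \<rho> * c)))
        \<le> integral {R..r} (\<lambda>\<rho>. (1 / R) * norm (expint t h (\<i> * \<omega> (of_real \<rho> * c))))"
    proof (rule integral_le)
      show "(\<lambda>\<rho>. norm (G_integrand h t s \<tau> (of_real \<rho> * c))) integrable_on {R..r}"
        by (intro integrable_continuous_real continuous_on_norm
              continuous_on_compose2[OF continuous_on_integrands(1)[OF ih]])
           (use R c in \<open>auto intro!: continuous_intros\<close>)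
      show "(\<lambda>\<rho>. (1 / R) * norm (expint t h (\<i> * \<omega> (of_real \<rho> * c)))) integrable_on {R..r}"
        by (intro integrable_continuous_real continuous_intros
              continuous_on_compose2[OF continuous_on_expint[OF ih, of UNIV]])
           (use R in \<open>auto simp: \<omega>_def intro!: continuous_intros\<close>)
      fix \<rho> assume \<rho>: "\<rho> \<in> {R..r}"
      then have \<rho>0: "\<rho> > 0" using R by auto
      have "norm (G_integrand h t s \<tau> (of_real \<rho> * c)) = exp (- (\<rho> * s * (sqrt 3 / 2))) * norm (expint t h (\<i> * \<omega> (of_real \<rho> * c))) * (1 / \<rho>)"
        unfolding G_integrand_eq norm_mult norm_divide norm_exponential_ray_le[OF c less_imp_le[OF \<rho>0] s]
        using ray_exponents(1)[OF c] \<rho>0 by (simp add: norm_mult)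
      also have "\<dots> \<le> 1 * norm (expint t h (\<i> * \<omega> (of_real \<rho> * c))) * (1 / R)"
        using \<rho> \<rho>0 R s by (intro mult_mono) (auto simp: frac_le)
      finally show "norm (G_integrand h t s \<tau> (of_real \<rho> * c)) \<le> (1 / R) * norm (expint t h (\<i> * \<omega> (of_real \<rho> * c)))"
        by (simp add: mult.commute)
    qed
    also have "\<dots> = (1 / R) * integral {R..r} (\<lambda>\<rho>. norm (expint t h (\<i> * \<omega> (of_real \<rho> * c))))" by simp
    also have "\<dots> \<le> (1 / R) * (2 * pi * (LINT s|lebesgue_on {0..T}. (cmod (h s))\<^sup>2) + 1 / R)"
      using expint_omega_ray_bound[OF R less_imp_le[OF r] t h c] R by (intro mult_left_mono) auto
    finally show "integral {R..r} (\<lambda>\<rho>. norm (G_integrand h t s \<tau> (of_real \<rho> * c))) \<le> \<dots>" .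
  qed
qed

section \<open>The solution formula and the error estimate\<close>

lemma q_integrand_decomposition:
  assumes H: "H1_with_derivative T g g'" and t: "0 < t" "t \<le> T" and k: "k \<noteq> 0"
  shows "q_integrand g x t k = 3 * g 0 * I_integrand x t k + 3 * G_integrand g' t x t k
     - 3 * g t * (exp (\<i> * k * of_real x) / (\<i> * k))"
proof -
  define z where "z = \<i> * \<omega> k"
  have z: "z = - (\<i> * k) * k\<^sup>2" by (simp add: z_def \<omega>_def power2_eq_square power3_eq_cube)
  have "(LINT s|lebesgue_on {0..t}. g s * (z * exp (z * of_real s))) + (LINT s|lebesgue_on {0..t}. g' s * exp (z * of_real s))
      = g t * exp (z * of_real t) - g 0 * exp (z * of_real 0)"
    by (rule weak_integration_by_parts[OF H t])
       (auto intro!: derivative_eq_intros has_vector_derivative_real_field continuous_intros)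
  moreover have "(LINT s|lebesgue_on {0..t}. g s * (z * exp (z * of_real s))) = z * expint t g z"
    unfolding expint_def integral_mult_right_zero[symmetric] by (simp add: mult.commute mult.left_commute)
  moreover have "(LINT s|lebesgue_on {0..t}. g' s * exp (z * of_real s)) = expint t g' z"
    by (simp add: expint_def mult.commute)
  ultimately have ibp: "z * expint t g z = g t * exp (z * of_real t) - g 0 - expint t g' z"
    by (simp add: eq_diff_eq)
  define X where "X = exp (\<i> * k * of_real x)"
  define W where "W = exp (z * of_real t)"
  have W: "W \<noteq> 0" by (simp add: W_def)
  have q: "q_integrand g x t k = 3 * k\<^sup>2 * (X / W) * expint t g z"
    by (simp add: q_integrand_def g_tilde_def expint_def z_def X_def W_def exp_diff)
  have "\<i> * k * q_integrand g x t k = - 3 * (X / W) * (z * expint t g z)"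
    unfolding q by (simp add: z)
  also have "\<dots> = - 3 * (X / W) * (g t * W - g 0 - expint t g' z)" by (simp only: ibp W_def)
  also have "\<dots> = 3 * g 0 * (X / W) + 3 * ((X / W) * expint t g' z) - 3 * g t * X"
    using W by (simp add: field_simps)
  finally have "q_integrand g x t k = (3 * g 0 * (X / W) + 3 * ((X / W) * expint t g' z) - 3 * g t * X) / (\<i> * k)"
    using k by (simp add: field_simps)
  also have "\<dots> = 3 * g 0 * ((X / W) / (\<i> * k)) + 3 * ((X / W) * expint t g' z / (\<i> * k)) - 3 * g t * (X / (\<i> * k))"
    by (simp add: add_divide_distrib diff_divide_distrib)
  finally show ?thesis
    by (simp add: I_integrand_def G_integrand_eq X_def W_def z_def exp_diff)
qed

lemma q_sol_representation:
  assumes R: "0 < R" and H: "H1_with_derivative T g g'" and t: "0 < t" "t \<le> T" and x: "0 < x"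
  shows "D1_integral_converges R (q_integrand g x t)"
    and "q_sol R g x t = - 3 * g 0 * I_\<omega>_0_1 R x t - 3 / (2 * of_real pi) * D1_integral R (G_integrand g' t x t)"
proof -
  define E where "E k = exp (\<i> * k * of_real x) / (\<i> * k)" for k
  have g: "g' square_integrable_on {0..T}" "g square_integrable_on {0..T}" using H by (auto simp: H1_with_derivative_def)
  have ig: "integrable (lebesgue_on {0..t}) g" "integrable (lebesgue_on {0..t}) g'"
    using square_integrable_imp_integrable[OF square_integrable_on_subset] g t by auto
  have I: "D1_integral_converges R (I_integrand x t)" by (rule I_integrand_converges[OF R x])
  have G: "D1_integral_converges R (G_integrand g' t x t)"
    by (rule G_integrand_converges[OF R t g(1)]) (use x in simp)
  have iE: "E contour_integrable_on bdry_D1 R r" if "R < r" for r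
    by (rule bdry_D1_integral(1)[OF R that]) (auto simp: E_def intro!: continuous_intros)
  have iI: "I_integrand x t contour_integrable_on bdry_D1 R r" if "R < r" for r
    using I that by (simp add: D1_integral_converges_def)
  have iG: "G_integrand g' t x t contour_integrable_on bdry_D1 R r" if "R < r" for r
    using G that by (simp add: D1_integral_converges_def)
  have iq: "q_integrand g x t contour_integrable_on bdry_D1 R r" if "R < r" for r
    by (rule bdry_D1_integral(1)[OF R that continuous_on_integrands(3)[OF ig(1)]])
  have eq: "contour_integral (bdry_D1 R r) (q_integrand g x t)
      = 3 * g 0 * contour_integral (bdry_D1 R r) (I_integrand x t)
        + 3 * contour_integral (bdry_D1 R r) (G_integrand g' t x t) - 3 * g t * contour_integral (bdry_D1 R r) E"
    if "R < r" for r
  proof -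
    have "k \<noteq> 0" if "k \<in> path_image (bdry_D1 R r)" for k
      using bdry_D1_in_upper_half_plane[OF R \<open>R < r\<close>] that by auto
    then have "contour_integral (bdry_D1 R r) (q_integrand g x t)
      = contour_integral (bdry_D1 R r) (\<lambda>k. 3 * g 0 * I_integrand x t k + 3 * G_integrand g' t x t k - 3 * g t * E k)"
      by (intro contour_integral_eq) (auto simp: q_integrand_decomposition[OF H t] E_def)
    also have "\<dots> = 3 * g 0 * contour_integral (bdry_D1 R r) (I_integrand x t)
        + 3 * contour_integral (bdry_D1 R r) (G_integrand g' t x t) - 3 * g t * contour_integral (bdry_D1 R r) E"
      using iE[OF that] iI[OF that] iG[OF that]
      by (simp add: contour_integral_diff contour_integral_add contour_integrable_lmul contour_integrable_add contour_integral_lmul)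
    finally show ?thesis .
  qed
  have lim: "((\<lambda>r. contour_integral (bdry_D1 R r) (q_integrand g x t)) \<longlongrightarrow>
      3 * g 0 * D1_integral R (I_integrand x t) + 3 * D1_integral R (G_integrand g' t x t) - 3 * g t * 0) at_top"
  proof (rule Lim_transform_eventually)
    show "((\<lambda>r. 3 * g 0 * contour_integral (bdry_D1 R r) (I_integrand x t)
        + 3 * contour_integral (bdry_D1 R r) (G_integrand g' t x t) - 3 * g t * contour_integral (bdry_D1 R r) E) \<longlongrightarrow>
      3 * g 0 * D1_integral R (I_integrand x t) + 3 * D1_integral R (G_integrand g' t x t) - 3 * g t * 0) at_top"
      using bdry_D1_integral_exp_tendsto_0[OF R x]
      by (intro tendsto_intros tendsto_D1_integral I G) (simp add: E_def[abs_def])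
    show "\<forall>\<^sub>F r in at_top. 3 * g 0 * contour_integral (bdry_D1 R r) (I_integrand x t)
        + 3 * contour_integral (bdry_D1 R r) (G_integrand g' t x t) - 3 * g t * contour_integral (bdry_D1 R r) E
       = contour_integral (bdry_D1 R r) (q_integrand g x t)"
      using eventually_gt_at_top[of R] by eventually_elim (simp add: eq)
  qed
  then show q: "D1_integral_converges R (q_integrand g x t)"
    using iq unfolding D1_integral_converges_def by blast
  have "D1_integral R (q_integrand g x t) = 3 * g 0 * D1_integral R (I_integrand x t) + 3 * D1_integral R (G_integrand g' t x t)"
    using tendsto_unique[OF _ tendsto_D1_integral[OF q] lim] by simp
  then show "q_sol R g x t = - 3 * g 0 * I_\<omega>_0_1 R x t - 3 / (2 * of_real pi) * D1_integral R (G_integrand g' t x t)"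
    by (simp add: q_sol_def I_\<omega>_0_1_def field_simps)
qed

text \<open>The first summand comes from the two rays, the second from the arc. The uniform upper bound \<open>X\<close> on
the positions is needed because $e^{ikx}$ is estimated on the arc by $e^{R|x|}$.\<close>

lemma D1_integral_G_diff_le:
  assumes R: "0 < R" and t: "0 < t" "t \<le> T" and \<tau>: "\<tau> \<le> T" and h: "h square_integrable_on {0..T}"
    and x: "0 \<le> x" "x \<le> X" and s: "0 \<le> s" "s \<le> X" "0 \<le> \<tau>"
  shows "norm (D1_integral R (G_integrand h t x t) - D1_integral R (G_integrand h t s \<tau>))
    \<le> 2 * (2 * pi * (LINT s|lebesgue_on {0..T}. (cmod (h s))\<^sup>2) + 1 / R) * (\<bar>x - s\<bar> + 2 * \<bar>t - \<tau>\<bar> powr (1/3))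
      + exp (R * X + 2 * R ^ 3 * T) * (LINT s|lebesgue_on {0..T}. norm (h s)) * (pi / 3) * (R * \<bar>x - s\<bar> + R ^ 3 * \<bar>t - \<tau>\<bar>)"
proof -
  define M where "M = 2 * pi * (LINT s|lebesgue_on {0..T}. (cmod (h s))\<^sup>2) + 1 / R"
  define N where "N = (LINT s|lebesgue_on {0..T}. norm (h s))"
  define D where "D k = G_integrand h t x t k - G_integrand h t s \<tau> k" for k
  define d where "d = \<bar>x - s\<bar> + 2 * \<bar>t - \<tau>\<bar> powr (1/3)"
  have d0: "0 \<le> d" by (simp add: d_def)
  have N0: "0 \<le> N" by (simp add: N_def)
  have T: "0 \<le> T" using t by simp
  have ihT: "integrable (lebesgue_on {0..T}) h" using h by (rule square_integrable_imp_integrable)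
  have ih: "integrable (lebesgue_on {0..t}) h"
    using square_integrable_imp_integrable[OF square_integrable_on_subset[OF h]] t by auto
  have cD: "continuous_on (- {0}) D"
    unfolding D_def by (intro continuous_intros continuous_on_integrands ih)
  have De: "D k = (exp (\<i> * k * of_real x - \<i> * \<omega> k * of_real t) - exp (\<i> * k * of_real s - \<i> * \<omega> k * of_real \<tau>))
      * expint t h (\<i> * \<omega> k) / (\<i> * k)" for k
    by (simp add: D_def G_integrand_eq left_diff_distrib diff_divide_distrib)
  have bound: "norm (contour_integral (bdry_D1 R r) D) \<le> 2 * (d * M)
     + (exp (R * X + R ^ 3 * T) * (R * \<bar>x - s\<bar> + R ^ 3 * \<bar>t - \<tau>\<bar>) * (exp (R ^ 3 * T) * N) * (1 / R)) * R * (pi / 3)" if r: "R < r" for r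
  proof (rule norm_bdry_D1_integral_le[OF R r cD])
    fix c :: complex assume c: "c \<in> {cis (pi / 3), cis (2 * pi / 3)}"
    have "integral {R..r} (\<lambda>\<rho>. norm (D (of_real \<rho> * c))) \<le> integral {R..r} (\<lambda>\<rho>. d * norm (expint t h (\<i> * \<omega> (of_real \<rho> * c))))"
    proof (rule integral_le)
      show "(\<lambda>\<rho>. norm (D (of_real \<rho> * c))) integrable_on {R..r}"
        by (intro integrable_continuous_real continuous_on_norm continuous_on_compose2[OF cD])
           (use R c in \<open>auto intro!: continuous_intros\<close>)
      show "(\<lambda>\<rho>. d * norm (expint t h (\<i> * \<omega> (of_real \<rho> * c)))) integrable_on {R..r}"
        by (intro integrable_continuous_real continuous_intros
              continuous_on_compose2[OF continuous_on_expint[OF ih, of UNIV]])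
           (auto simp: \<omega>_def intro!: continuous_intros)
      fix \<rho> assume "\<rho> \<in> {R..r}"
      then have \<rho>: "\<rho> > 0" using R by auto
      have "norm (D (of_real \<rho> * c)) \<le> (\<rho> * d) * norm (expint t h (\<i> * \<omega> (of_real \<rho> * c))) / norm (\<i> * (of_real \<rho> * c))"
        unfolding De norm_mult norm_divide d_def
        by (intro divide_right_mono mult_right_mono norm_exponential_diff_ray_le c) (use \<rho> x s in auto)
      also have "\<dots> = d * norm (expint t h (\<i> * \<omega> (of_real \<rho> * c)))"
        using \<rho> ray_exponents(1)[OF c] by (simp add: norm_mult)
      finally show "norm (D (of_real \<rho> * c)) \<le> d * norm (expint t h (\<i> * \<omega> (of_real \<rho> * c)))" .
    qed
    also have "\<dots> = d * integral {R..r} (\<lambda>\<rho>. norm (expint t h (\<i> * \<omega> (of_real \<rho> * c))))" by simp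
    also have "\<dots> \<le> d * M"
      unfolding M_def using expint_omega_ray_bound[OF R less_imp_le[OF r] t h c] d0 by (intro mult_left_mono) auto
    finally show "integral {R..r} (\<lambda>\<rho>. norm (D (of_real \<rho> * c))) \<le> d * M" .
  next
    fix k :: complex assume k: "norm k = R"
    have w: "norm (\<i> * \<omega> k) = R ^ 3" using k by (simp add: \<omega>_def norm_mult norm_power)
    have Re: "Re (\<i> * k * of_real y - \<i> * \<omega> k * of_real u) \<le> R * X + R ^ 3 * T"
      if "0 \<le> y" "y \<le> X" "0 \<le> u" "u \<le> T" for y u
    proof -
      have "norm (\<i> * k * of_real y - \<i> * \<omega> k * of_real u) \<le> norm (\<i> * k * of_real y) + norm (\<i> * \<omega> k * of_real u)"
        by (rule norm_triangle_ineq4)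
      also have "\<dots> = R * y + R ^ 3 * u" using k w that by (simp add: norm_mult)
      also have "\<dots> \<le> R * X + R ^ 3 * T" using that R by (intro add_mono mult_left_mono) auto
      finally show ?thesis using complex_Re_le_cmod order_trans by blast
    qed
    have "norm (exp (\<i> * k * of_real x - \<i> * \<omega> k * of_real t) - exp (\<i> * k * of_real s - \<i> * \<omega> k * of_real \<tau>))
        \<le> exp (R * X + R ^ 3 * T) * norm ((\<i> * k * of_real x - \<i> * \<omega> k * of_real t) - (\<i> * k * of_real s - \<i> * \<omega> k * of_real \<tau>))"
      using x s t \<tau> by (intro norm_exp_diff_le Re) auto
    also have "(\<i> * k * of_real x - \<i> * \<omega> k * of_real t) - (\<i> * k * of_real s - \<i> * \<omega> k * of_real \<tau>)
        = \<i> * k * of_real (x - s) - \<i> * \<omega> k * of_real (t - \<tau>)" by (simp add: algebra_simps)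
    also have "norm \<dots> \<le> R * \<bar>x - s\<bar> + R ^ 3 * \<bar>t - \<tau>\<bar>"
      using norm_triangle_ineq4[of "\<i> * k * of_real (x - s)" "\<i> * \<omega> k * of_real (t - \<tau>)"] k w
      by (simp only: norm_mult norm_of_real norm_ii mult_1)
    finally have e: "norm (exp (\<i> * k * of_real x - \<i> * \<omega> k * of_real t) - exp (\<i> * k * of_real s - \<i> * \<omega> k * of_real \<tau>))
        \<le> exp (R * X + R ^ 3 * T) * (R * \<bar>x - s\<bar> + R ^ 3 * \<bar>t - \<tau>\<bar>)" by simp
    have g: "norm (expint t h (\<i> * \<omega> k)) \<le> exp (R ^ 3 * T) * N"
      unfolding N_def using complex_Re_le_cmod[of "\<i> * \<omega> k"] w R
      by (intro norm_expint_le[OF ihT t(2) T]) auto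
    have n: "1 / norm (\<i> * k) = 1 / R" using k by (simp add: norm_mult)
    have "norm (D k) = norm (exp (\<i> * k * of_real x - \<i> * \<omega> k * of_real t) - exp (\<i> * k * of_real s - \<i> * \<omega> k * of_real \<tau>))
       * norm (expint t h (\<i> * \<omega> k)) * (1 / R)"
      unfolding De norm_mult norm_divide n[symmetric] by simp
    also have "\<dots> \<le> exp (R * X + R ^ 3 * T) * (R * \<bar>x - s\<bar> + R ^ 3 * \<bar>t - \<tau>\<bar>) * (exp (R ^ 3 * T) * N) * (1 / R)"
      by (intro mult_mono e g) (use R N0 in auto)
    finally show "norm (D k) \<le> \<dots>" .
  qed
  have G1: "D1_integral_converges R (G_integrand h t x t)" and G2: "D1_integral_converges R (G_integrand h t s \<tau>)"
    using G_integrand_converges[OF R t h] x s by auto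
  have "((\<lambda>r. contour_integral (bdry_D1 R r) (G_integrand h t x t) - contour_integral (bdry_D1 R r) (G_integrand h t s \<tau>))
      \<longlongrightarrow> D1_integral R (G_integrand h t x t) - D1_integral R (G_integrand h t s \<tau>)) at_top"
    by (intro tendsto_intros tendsto_D1_integral G1 G2)
  moreover have "\<forall>\<^sub>F r in at_top. norm (contour_integral (bdry_D1 R r) (G_integrand h t x t) - contour_integral (bdry_D1 R r) (G_integrand h t s \<tau>))
     \<le> 2 * (d * M) + (exp (R * X + R ^ 3 * T) * (R * \<bar>x - s\<bar> + R ^ 3 * \<bar>t - \<tau>\<bar>) * (exp (R ^ 3 * T) * N) * (1 / R)) * R * (pi / 3)"
    using eventually_gt_at_top[of R]
  proof eventually_elim
    case (elim r)
    have "contour_integral (bdry_D1 R r) D = contour_integral (bdry_D1 R r) (G_integrand h t x t) - contour_integral (bdry_D1 R r) (G_integrand h t s \<tau>)"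
      unfolding D_def using G1 G2 elim by (intro contour_integral_diff) (auto simp: D1_integral_converges_def)
    then show ?case using bound[OF elim] by simp
  qed
  ultimately have "norm (D1_integral R (G_integrand h t x t) - D1_integral R (G_integrand h t s \<tau>))
     \<le> 2 * (d * M) + (exp (R * X + R ^ 3 * T) * (R * \<bar>x - s\<bar> + R ^ 3 * \<bar>t - \<tau>\<bar>) * (exp (R ^ 3 * T) * N) * (1 / R)) * R * (pi / 3)"
    by (rule tendsto_norm[THEN tendsto_upperbound]) simp
  also have "(exp (R * X + R ^ 3 * T) * (R * \<bar>x - s\<bar> + R ^ 3 * \<bar>t - \<tau>\<bar>) * (exp (R ^ 3 * T) * N) * (1 / R)) * R * (pi / 3)
     = (exp (R * X + R ^ 3 * T) * exp (R ^ 3 * T)) * N * (pi / 3) * (R * \<bar>x - s\<bar> + R ^ 3 * \<bar>t - \<tau>\<bar>)"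
    using R by simp
  also have "exp (R * X + R ^ 3 * T) * exp (R ^ 3 * T) = exp (R * X + 2 * R ^ 3 * T)"
    unfolding exp_add[symmetric] by (simp add: algebra_simps)
  finally show ?thesis unfolding M_def N_def d_def by (simp only: mult.commute mult.left_commute)
qed

theorem mainTheorem5:
  fixes R T :: real and g\<^sub>0 g\<^sub>0' :: "real \<Rightarrow> complex"
  assumes "R > 0" and "T > 0"
    and "H1_with_derivative T g\<^sub>0 g\<^sub>0'"
  shows
    "(\<forall>x>0. \<forall>t\<in>{0<..T}.
        D1_integral_converges R (q_integrand g\<^sub>0 x t) \<and>
        D1_integral_converges R (I_integrand x t)) \<and>
     (\<forall>(s, \<tau>) \<in> closure ({0<..} \<times> {0<..<T}).
        (\<forall>t\<in>{0<..T}. D1_integral_converges R (G_integrand g\<^sub>0' t s \<tau>)) \<and>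
        (\<lambda>(x, t). cmod (q_sol R g\<^sub>0 x t -
             (- 3 * g\<^sub>0 0 * I_\<omega>_0_1 R x t
              - 3 / (2 * of_real pi) * D1_integral R (G_integrand g\<^sub>0' t s \<tau>))))
          \<in> O[at (s, \<tau>) within ({0<..} \<times> {0<..T})](\<lambda>(x, t). \<bar>x - s\<bar> powr (1/2) + \<bar>t - \<tau>\<bar> powr (1/6)))"
proof (intro conjI ballI allI impI, goal_cases)
  case (1 x t)
  then show ?case using q_sol_representation(1)[OF assms(1,3)] by auto
next
  case (2 x t)
  then show ?case using I_integrand_converges[OF assms(1)] by auto
next
  case (3 p)
  have g': "g\<^sub>0' square_integrable_on {0..T}" using assms(3) by (simp add: H1_with_derivative_def)
  obtain s \<tau> where p: "p = (s, \<tau>)" by (cases p)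
  have "closure ({0<..} \<times> {0<..<T}) = {0::real..} \<times> {0..T}"
    using assms(2) by (simp add: closure_Times closure_greaterThanLessThan)
  then have st: "0 \<le> s" "0 \<le> \<tau>" "\<tau> \<le> T" using 3 p by auto
  define M where "M = 2 * pi * (LINT s|lebesgue_on {0..T}. (cmod (g\<^sub>0' s))\<^sup>2) + 1 / R"
  define K where "K = exp (R * (s + 1) + 2 * R ^ 3 * T) * (LINT s|lebesgue_on {0..T}. norm (g\<^sub>0' s)) * (pi / 3)"
  define C where "C = 4 * M + K * (R + R ^ 3)"
  have M0: "0 \<le> M" unfolding M_def using assms(1) by (intro add_nonneg_nonneg mult_nonneg_nonneg) auto
  have K0: "0 \<le> K" unfolding K_def by (intro mult_nonneg_nonneg) auto
  have near: "cmod (q_sol R g\<^sub>0 x t - (- 3 * g\<^sub>0 0 * I_\<omega>_0_1 R x t - 3 / (2 * of_real pi) * D1_integral R (G_integrand g\<^sub>0' t s \<tau>)))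
      \<le> C * (\<bar>x - s\<bar> powr (1/2) + \<bar>t - \<tau>\<bar> powr (1/6))"
    if x: "0 < x" "\<bar>x - s\<bar> \<le> 1" and t: "0 < t" "t \<le> T" "\<bar>t - \<tau>\<bar> \<le> 1" for x t
  proof -
    let ?D = "D1_integral R (G_integrand g\<^sub>0' t x t) - D1_integral R (G_integrand g\<^sub>0' t s \<tau>)"
    let ?a = "\<bar>x - s\<bar> powr (1/2)" and ?b = "\<bar>t - \<tau>\<bar> powr (1/6)"
    have pw: "\<bar>y\<bar> powr q \<le> \<bar>y\<bar> powr p" if "\<bar>y\<bar> \<le> 1" "0 \<le> p" "p \<le> q" for y p q :: real
      using that powr_mono'[of p q "\<bar>y\<bar>"] by simp
    have a: "\<bar>x - s\<bar> \<le> ?a" using pw[OF x(2), of "1/2" 1] by simp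
    have b: "\<bar>t - \<tau>\<bar> powr (1/3) \<le> ?b" "\<bar>t - \<tau>\<bar> \<le> ?b" using pw[OF t(3), of "1/6"] pw[OF t(3), of "1/6" 1] by simp_all
    have "norm ?D \<le> 2 * M * (\<bar>x - s\<bar> + 2 * \<bar>t - \<tau>\<bar> powr (1/3)) + K * (R * \<bar>x - s\<bar> + R ^ 3 * \<bar>t - \<tau>\<bar>)"
      unfolding M_def K_def
      by (rule D1_integral_G_diff_le[OF assms(1) t(1,2) st(3) g']) (use x st in auto)
    also have "\<dots> \<le> 2 * M * (2 * (?a + ?b)) + K * (R * (?a + ?b) + R ^ 3 * (?a + ?b))"
    proof -
      have lin: "u + 2 * v \<le> 2 * (a + b)" if "u \<le> a" "v \<le> b" "0 \<le> a" for u a v b :: real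
        using that by (simp add: distrib_left)
      have "0 \<le> ?a" "0 \<le> ?b" by simp_all
      then have "\<bar>x - s\<bar> \<le> ?a + ?b" "\<bar>t - \<tau>\<bar> \<le> ?a + ?b"
        "\<bar>x - s\<bar> + 2 * \<bar>t - \<tau>\<bar> powr (1/3) \<le> 2 * (?a + ?b)"
        using a b lin[of "\<bar>x - s\<bar>" ?a "\<bar>t - \<tau>\<bar> powr (1/3)" ?b]
        by (auto intro: add_increasing add_increasing2)
      then show ?thesis using M0 K0 assms(1) by (intro add_mono mult_left_mono) auto
    qed
    also have "\<dots> = C * (?a + ?b)" by (simp add: C_def algebra_simps)
    finally have D: "norm ?D \<le> C * (?a + ?b)" .
    have "q_sol R g\<^sub>0 x t - (- 3 * g\<^sub>0 0 * I_\<omega>_0_1 R x t - 3 / (2 * of_real pi) * D1_integral R (G_integrand g\<^sub>0' t s \<tau>))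
      = - (3 / (2 * of_real pi)) * ?D"
      unfolding q_sol_representation(2)[OF assms(1,3) t(1,2) x(1)] by (simp add: algebra_simps)
    then have "cmod (q_sol R g\<^sub>0 x t - (- 3 * g\<^sub>0 0 * I_\<omega>_0_1 R x t - 3 / (2 * of_real pi) * D1_integral R (G_integrand g\<^sub>0' t s \<tau>)))
      = (3 / (2 * pi)) * norm ?D" by (simp only: norm_mult norm_minus_cancel norm_divide) simp
    also have "\<dots> \<le> 1 * norm ?D" using pi_gt3 by (intro mult_right_mono) auto
    finally show ?thesis using D by simp
  qed
  have "(\<lambda>(x, t). cmod (q_sol R g\<^sub>0 x t -
             (- 3 * g\<^sub>0 0 * I_\<omega>_0_1 R x t
              - 3 / (2 * of_real pi) * D1_integral R (G_integrand g\<^sub>0' t s \<tau>))))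
          \<in> O[at (s, \<tau>) within ({0<..} \<times> {0<..T})](\<lambda>(x, t). \<bar>x - s\<bar> powr (1/2) + \<bar>t - \<tau>\<bar> powr (1/6))"
  proof (rule bigoI[where c = C])
    have "\<forall>\<^sub>F y in at (s, \<tau>) within ({0<..} \<times> {0<..T}). y \<in> {0<..} \<times> {0<..T} \<and> dist y (s, \<tau>) < 1"
      unfolding eventually_at by (rule exI[of _ 1]) auto
    then show "\<forall>\<^sub>F y in at (s, \<tau>) within ({0<..} \<times> {0<..T}).
      norm (case y of (x, t) \<Rightarrow> cmod (q_sol R g\<^sub>0 x t -
             (- 3 * g\<^sub>0 0 * I_\<omega>_0_1 R x t
              - 3 / (2 * of_real pi) * D1_integral R (G_integrand g\<^sub>0' t s \<tau>))))
       \<le> C * norm (case y of (x, t) \<Rightarrow> \<bar>x - s\<bar> powr (1/2) + \<bar>t - \<tau>\<bar> powr (1/6))"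
    proof eventually_elim
      case (elim y)
      obtain x t where y: "y = (x, t)" by (cases y)
      have "\<bar>x - s\<bar> \<le> 1" "\<bar>t - \<tau>\<bar> \<le> 1"
        using elim dist_fst_le[of y "(s, \<tau>)"] dist_snd_le[of y "(s, \<tau>)"] by (auto simp: y dist_real_def)
      then show ?case using near[of x t] elim by (simp add: y)
    qed
  qed
  moreover have "\<forall>t\<in>{0<..T}. D1_integral_converges R (G_integrand g\<^sub>0' t s \<tau>)"
    using G_integrand_converges[OF assms(1) _ _ g' st(1)] by auto
  ultimately show ?case by (simp add: p)
qed

end
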